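(* Let $r_1,r_2,n,k$ be positive integers with $\min\{r_1,r_2\}<n$, $\max\{r_1,r_2\}\le n$, $1\le k\le n^2$, and let $\boldsymbol{\rho}=(\rho_1,\dots,\rho_k)$ be integers with $1\le\rho_\ell\le n^2$ and $\sum_{\ell\in[k]}\rho_\ell=n^2$. Let $M$ be an $r_1\times r_2$ equitable $\boldsymbol{\rho}$-Latin rectangle. Then $M$ extends to an $n\times n$ equitable $\boldsymbol{\rho}$-Latin square if and only if there exists a sequence $\{(a_{\ell1},a_{\ell2})\}_{\ell\in[k]}$ that is feasible with respect to $M$ and such that for $t=1,2$, $$\rho_\ell-|M_\ell|\ \ge\ (n-r_t)\left\lfloor\frac{\rho_\ell}{n}\right\rfloor\quad\text{for all }\ell\in[k],$$ $$n|Z|\ \ge\ \sum_{\ell\in[k]}\Big(|Z|\left\lceil\frac{\rho_\ell}{n}\right\rceil-\min\{f_t(\ell),\eta^{(t)}_Z(\ell)\}\Big)\quad\text{for all }Z\subseteq[r_t],$$ where $$f_t(\ell)=r_t\left\lceil\frac{\rho_\ell}{n}\right\rceil+(n-r_t)\left\lfloor\frac{\rho_\ell}{n}\right\rfloor-\rho_\ell+a_{\ell t}.$$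
   Context: $[m]=\{1,\dots,m\}$. An $r_1\times r_2$ array on $[k]$ has rows indexed by $[r_1]$ and columns indexed by $[r_2]$, and each cell contains exactly one symbol from $[k]$. For an array $M$, $|M_\ell|$, $|M_\ell^i|$, $|{}^jM_\ell|$ denote the number of occurrences of symbol $\ell$ in $M$, in row $i$ of $M$, and in column $j$ of $M$, respectively. Equitable $\boldsymbol{\rho}$-Latin rectangle: an $r_1\times r_2$ array $M$ on $[k]$ (with $r_1,r_2\le n$) such that for all $\ell\in[k]$, $i\in[r_1]$, $j\in[r_2]$: $|M_\ell^i|\le\lceil\rho_\ell/n\rceil$, $|{}^jM_\ell|\le\lceil\rho_\ell/n\rceil$, $|M_\ell|\le\rho_\ell$; moreover if $r_2=n$ (rows are full) then $|M_\ell^i|\ge\lfloor\rho_\ell/n\rfloor$; if $r_1=n$ (columns are full) then $|{}^jM_\ell|\ge\lfloor\rho_\ell/n\rfloor$; and if $r_1=r_2=n$ then $|M_\ell|=\rho_\ell$. When $r_1=r_2=n$ it is called an equitable $\boldsymbol{\rho}$-Latin square. $M$ extends to an $n\times n$ array $N$ if the top-left $r_1\times r_2$ subarray of $N$ is $M$. A symbol $\ell$ is free if $n\nmid\rho_\ell$, and forced otherwise. A row $i\in[r_1]$ (resp. column $j\in[r_2]$) of $M$ is $\ell$-saturated if $\ell$ appears exactly $\lceil\rho_\ell/n\rceil$ times in it, and $\ell$-unsaturated otherwise. For a free symbol $\ell$: for $Z\subseteq[r_1]$, $\eta^{(1)}_Z(\ell)$ is the number of $\ell$-unsaturated rows of $M$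 with index in $Z$; for $Z\subseteq[r_2]$, $\eta^{(2)}_Z(\ell)$ is the number of $\ell$-unsaturated columns of $M$ with index in $Z$. For a forced symbol $\ell$, $\eta^{(1)}_Z(\ell)=\eta^{(2)}_Z(\ell)=0$. Feasible sequence: a sequence $\{(a_{\ell1},a_{\ell2})\}_{\ell\in[k]}$ of pairs of non-negative integers is feasible with respect to $M$ if for $t=1,2$ and all $\ell\in[k]$: (i) $a_{\ell t}\ge\rho_\ell-r_t\lceil\rho_\ell/n\rceil-(n-r_t)\lfloor\rho_\ell/n\rfloor$; (ii) $a_{\ell t}\le\min\{n\lceil\rho_\ell/n\rceil,\ \rho_\ell+\eta^{(t)}_{[r_t]}(\ell)\}-r_t\lceil\rho_\ell/n\rceil-(n-r_t)\lfloor\rho_\ell/n\rfloor$; (iii) $a_{\ell1}+a_{\ell2}\ge\rho_\ell-|M_\ell|-(2n-r_1-r_2)\lfloor\rho_\ell/n\rfloor$; (iv) $\sum_{\ell\in[k]}a_{\ell t}=(n-r_t)\big(n-\sum_{\ell\in[k]}\lfloor\rho_\ell/n\rfloor\big)$. *)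

theory Defs
  imports Complex_Main
begin

text \<open>
  An array is a function \<open>M\<close> with \<open>M i j\<close> the symbol in row \<open>i\<close>, column \<open>j\<close>; indices and symbols
  start at 1. Only cells in \<open>{1..r1} \<times> {1..r2}\<close> are meaningful, so every notion below takes the
  dimensions as arguments and ignores all other cells.
\<close>

type_synonym array = "nat \<Rightarrow> nat \<Rightarrow> nat"

definition is_array :: "nat \<Rightarrow> nat \<Rightarrow> nat \<Rightarrow> array \<Rightarrow> bool" where
  "is_array k r1 r2 M \<longleftrightarrow> (\<forall>i\<in>{1..r1}. \<forall>j\<in>{1..r2}. M i j \<in> {1..k})"

definition occ :: "nat \<Rightarrow> nat \<Rightarrow> array \<Rightarrow> nat \<Rightarrow> nat" where
  "occ r1 r2 M l = card {(i, j). i \<in> {1..r1} \<and> j \<in> {1..r2} \<and> M i j = l}"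

definition row_occ :: "nat \<Rightarrow> array \<Rightarrow> nat \<Rightarrow> nat \<Rightarrow> nat" where
  "row_occ r2 M i l = card {j \<in> {1..r2}. M i j = l}"

definition col_occ :: "nat \<Rightarrow> array \<Rightarrow> nat \<Rightarrow> nat \<Rightarrow> nat" where
  "col_occ r1 M j l = card {i \<in> {1..r1}. M i j = l}"

definition rho_floor :: "nat \<Rightarrow> (nat \<Rightarrow> nat) \<Rightarrow> nat \<Rightarrow> int" where
  "rho_floor n \<rho> l = \<lfloor>real (\<rho> l) / real n\<rfloor>"

definition rho_ceil :: "nat \<Rightarrow> (nat \<Rightarrow> nat) \<Rightarrow> nat \<Rightarrow> int" where
  "rho_ceil n \<rho> l = \<lceil>real (\<rho> l) / real n\<rceil>"

definition equitable_latin_rectangle ::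
    "nat \<Rightarrow> nat \<Rightarrow> (nat \<Rightarrow> nat) \<Rightarrow> nat \<Rightarrow> nat \<Rightarrow> array \<Rightarrow> bool" where
  "equitable_latin_rectangle n k \<rho> r1 r2 M \<longleftrightarrow>
     r1 \<le> n \<and> r2 \<le> n \<and> is_array k r1 r2 M \<and>
     (\<forall>l\<in>{1..k}. \<forall>i\<in>{1..r1}. \<forall>j\<in>{1..r2}.
        int (row_occ r2 M i l) \<le> rho_ceil n \<rho> l \<and>
        int (col_occ r1 M j l) \<le> rho_ceil n \<rho> l \<and>
        occ r1 r2 M l \<le> \<rho> l \<and>
        (r2 = n \<longrightarrow> int (row_occ r2 M i l) \<ge> rho_floor n \<rho> l) \<and>
        (r1 = n \<longrightarrow> int (col_occ r1 M j l) \<ge> rho_floor n \<rho> l) \<and>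
        (r1 = n \<and> r2 = n \<longrightarrow> occ r1 r2 M l = \<rho> l))"

abbreviation equitable_latin_square ::
    "nat \<Rightarrow> nat \<Rightarrow> (nat \<Rightarrow> nat) \<Rightarrow> array \<Rightarrow> bool" where
  "equitable_latin_square n k \<rho> N \<equiv> equitable_latin_rectangle n k \<rho> n n N"

definition extends_to :: "nat \<Rightarrow> nat \<Rightarrow> array \<Rightarrow> array \<Rightarrow> bool" where
  "extends_to r1 r2 M N \<longleftrightarrow> (\<forall>i\<in>{1..r1}. \<forall>j\<in>{1..r2}. N i j = M i j)"

definition free_symbol :: "nat \<Rightarrow> (nat \<Rightarrow> nat) \<Rightarrow> nat \<Rightarrow> bool" where
  "free_symbol n \<rho> l \<longleftrightarrow> \<not> n dvd \<rho> l"

text \<open>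
  The index \<open>t \<in> {1, 2}\<close> selects rows (\<open>t = 1\<close>) or columns (\<open>t = 2\<close>).
\<close>

definition num_lines :: "nat \<Rightarrow> nat \<Rightarrow> nat \<Rightarrow> nat" where
  "num_lines r1 r2 t = (if t = 1 then r1 else r2)"

definition line_occ :: "nat \<Rightarrow> nat \<Rightarrow> array \<Rightarrow> nat \<Rightarrow> nat \<Rightarrow> nat \<Rightarrow> nat" where
  "line_occ r1 r2 M t x l = (if t = 1 then row_occ r2 M x l else col_occ r1 M x l)"

definition saturated ::
    "nat \<Rightarrow> (nat \<Rightarrow> nat) \<Rightarrow> nat \<Rightarrow> nat \<Rightarrow> array \<Rightarrow> nat \<Rightarrow> nat \<Rightarrow> nat \<Rightarrow> bool" where
  "saturated n \<rho> r1 r2 M t x l \<longleftrightarrow> int (line_occ r1 r2 M t x l) = rho_ceil n \<rho> l"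

definition eta ::
    "nat \<Rightarrow> (nat \<Rightarrow> nat) \<Rightarrow> nat \<Rightarrow> nat \<Rightarrow> array \<Rightarrow> nat \<Rightarrow> nat set \<Rightarrow> nat \<Rightarrow> nat" where
  "eta n \<rho> r1 r2 M t Z l =
     (if free_symbol n \<rho> l then card {x \<in> Z. \<not> saturated n \<rho> r1 r2 M t x l} else 0)"

text \<open>
  The sequence of pairs is given as \<open>a l t\<close> with \<open>l \<in> {1..k}\<close> and \<open>t \<in> {1, 2}\<close>. All
  subtractions are in \<^typ>\<open>int\<close>.
\<close>

definition feasible ::
    "nat \<Rightarrow> nat \<Rightarrow> (nat \<Rightarrow> nat) \<Rightarrow> nat \<Rightarrow> nat \<Rightarrow> array \<Rightarrow> (nat \<Rightarrow> nat \<Rightarrow> nat) \<Rightarrow> bool" where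
  "feasible n k \<rho> r1 r2 M a \<longleftrightarrow>
     (\<forall>t\<in>{1, 2}.
        (\<forall>l\<in>{1..k}.
           int (a l t) \<ge> int (\<rho> l) - int (num_lines r1 r2 t) * rho_ceil n \<rho> l
                          - (int n - int (num_lines r1 r2 t)) * rho_floor n \<rho> l \<and>
           int (a l t) \<le> min (int n * rho_ceil n \<rho> l)
                             (int (\<rho> l) + int (eta n \<rho> r1 r2 M t {1..num_lines r1 r2 t} l))
                          - int (num_lines r1 r2 t) * rho_ceil n \<rho> l
                          - (int n - int (num_lines r1 r2 t)) * rho_floor n \<rho> l \<and>
           int (a l 1) + int (a l 2) \<ge> int (\<rho> l) - int (occ r1 r2 M l)
                          - (2 * int n - int r1 - int r2) * rho_floor n \<rho> l) \<and>
        (\<Sum>l\<in>{1..k}. int (a l t)) =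
          (int n - int (num_lines r1 r2 t)) * (int n - (\<Sum>l\<in>{1..k}. rho_floor n \<rho> l)))"

definition f_val ::
    "nat \<Rightarrow> (nat \<Rightarrow> nat) \<Rightarrow> nat \<Rightarrow> nat \<Rightarrow> (nat \<Rightarrow> nat \<Rightarrow> nat) \<Rightarrow> nat \<Rightarrow> nat \<Rightarrow> int" where
  "f_val n \<rho> r1 r2 a t l =
     int (num_lines r1 r2 t) * rho_ceil n \<rho> l + (int n - int (num_lines r1 r2 t)) * rho_floor n \<rho> l
       - int (\<rho> l) + int (a l t)"

end

theory Submission
  imports Defs
begin

text \<open>
  In an extension, let \<open>a l t\<close> count the new lines of direction \<open>t\<close> that are \<open>l\<close>-saturated for a free
  symbol \<open>l\<close>; then \<open>f_val\<close> counts the old lines that stay \<open>l\<close>-unsaturated, and necessity is double counting.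
  Conversely, the condition on the sets \<open>Z\<close> is exactly Hall's condition for choosing, for each old line,
  the symbols that remain unsaturated in it so that \<open>l\<close> is chosen \<open>f_val\<close> times. This fixes the content
  of all old lines, and the number of copies of each symbol in the new corner. Merging all
  new rows into one and all new columns into one gives bipartite multigraphs whose balanced
  edge decompositions (into one class per new line) split them again: first the rows, then the columns.
\<close>

section \<open>Transport and balanced decomposition of bipartite multigraphs\<close>

text \<open>
  As in Hall's theorem: a tight proper subset splits the problem in two; if there is none, one unit can
  be sent along any usable edge.
\<close>

lemma capacitated_transport:
  fixes u :: "'a \<Rightarrow> 'b \<Rightarrow> nat" and b :: "'a \<Rightarrow> nat" and f :: "'b \<Rightarrow> nat"
  assumes "finite X" and "finite Y"
    and "\<And>Z. Z \<subseteq> X \<Longrightarrow> sum b Z \<le> (\<Sum>y\<in>Y. min (f y) (\<Sum>x\<in>Z. u x y))"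
  shows "\<exists>v. (\<forall>x\<in>X. \<forall>y\<in>Y. v x y \<le> u x y) \<and> (\<forall>x\<in>X. (\<Sum>y\<in>Y. v x y) = b x) \<and>
           (\<forall>y\<in>Y. (\<Sum>x\<in>X. v x y) \<le> f y)"
  using assms(1,3)
\<comment> \<open>A tight split lowers \<open>card X\<close> without raising \<open>sum b X\<close>;
  sending one unit keeps \<open>X\<close> and lowers \<open>sum b X\<close>.\<close>
proof (induction "card X + sum b X" arbitrary: X b f u rule: less_induct)
  case less
  note finX = less.prems(1) and hall = less.prems(2)
  show ?case
  proof (cases "\<exists>Z. Z \<subset> X \<and> Z \<noteq> {} \<and> sum b Z = (\<Sum>y\<in>Y. min (f y) (\<Sum>x\<in>Z. u x y))")
    case True
    then obtain Z where Z: "Z \<subset> X" "Z \<noteq> {}"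
      and tight: "sum b Z = (\<Sum>y\<in>Y. min (f y) (\<Sum>x\<in>Z. u x y))" by blast
    have finZ: "finite Z" using Z finX by (meson finite_subset psubset_imp_subset)
    have cards: "card Z < card X" "card (X - Z) < card X"
      using Z finX by (auto intro: psubset_card_mono)
    have sums: "sum b Z \<le> sum b X" "sum b (X - Z) \<le> sum b X"
      using Z finX by (auto intro: sum_mono2)
    obtain v1 where v1: "\<forall>x\<in>Z. \<forall>y\<in>Y. v1 x y \<le> u x y" "\<forall>x\<in>Z. (\<Sum>y\<in>Y. v1 x y) = b x"
        "\<forall>y\<in>Y. (\<Sum>x\<in>Z. v1 x y) \<le> f y"
      using less.hyps[OF add_less_le_mono[OF cards(1) sums(1)] finZ, of f u] hall Z(1) by blast
    \<comment> \<open>Truncated subtraction: \<open>f' y\<close> is what \<open>f y\<close> retains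
      once \<open>Z\<close> has used all its capacity into \<open>y\<close>. Hence
      \<open>min (f y) (p + q) = min (f y) p + min (f' y) q\<close> with
      \<open>p = (\<Sum>x\<in>Z. u x y)\<close>.\<close>
    define f' where "f' y = f y - (\<Sum>x\<in>Z. u x y)" for y
    have hall': "sum b W \<le> (\<Sum>y\<in>Y. min (f' y) (\<Sum>x\<in>W. u x y))" if W: "W \<subseteq> X - Z" for W
    proof -
      have finW: "finite W" and disj: "Z \<inter> W = {}" using W finX by (auto intro: finite_subset)
      have "sum b Z + sum b W = sum b (Z \<union> W)"
        using finZ finW disj by (simp add: sum.union_disjoint)
      also have "\<dots> \<le> (\<Sum>y\<in>Y. min (f y) (\<Sum>x\<in>Z \<union> W. u x y))"
        using W Z by (intro hall) auto
      also have "\<dots> = (\<Sum>y\<in>Y. min (f y) (\<Sum>x\<in>Z. u x y) + min (f' y) (\<Sum>x\<in>W. u x y))"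
        using finZ finW disj by (intro sum.cong) (auto simp: sum.union_disjoint f'_def)
      finally show ?thesis using tight by (simp add: sum.distrib)
    qed
    obtain v2 where v2: "\<forall>x\<in>X-Z. \<forall>y\<in>Y. v2 x y \<le> u x y" "\<forall>x\<in>X-Z. (\<Sum>y\<in>Y. v2 x y) = b x"
        "\<forall>y\<in>Y. (\<Sum>x\<in>X-Z. v2 x y) \<le> f' y"
      using less.hyps[OF add_less_le_mono[OF cards(2) sums(2)] finite_Diff[OF finX] hall'] by blast
    define v where "v x = (if x \<in> Z then v1 x else v2 x)" for x
    \<comment> \<open>If the capacity of \<open>Z\<close> into \<open>y\<close> is at most
      \<open>f y\<close>, the two parts are bounded by that capacity and by the remainder; otherwise
      \<open>f' y = 0\<close> and \<open>v1\<close> alone respects \<open>f y\<close>.\<close>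
    have "(\<Sum>x\<in>X. v x y) \<le> f y" if y: "y \<in> Y" for y
    proof -
      have "(\<Sum>x\<in>X. v x y) = (\<Sum>x\<in>X-Z. v x y) + (\<Sum>x\<in>Z. v x y)"
        using finX Z by (intro sum.subset_diff) auto
      also have "(\<Sum>x\<in>X-Z. v x y) = (\<Sum>x\<in>X-Z. v2 x y)" by (auto simp: v_def intro: sum.cong)
      also have "(\<Sum>x\<in>Z. v x y) = (\<Sum>x\<in>Z. v1 x y)" by (auto simp: v_def intro: sum.cong)
      finally have "(\<Sum>x\<in>X. v x y) = (\<Sum>x\<in>X-Z. v2 x y) + (\<Sum>x\<in>Z. v1 x y)" .
      moreover have "(\<Sum>x\<in>X-Z. v2 x y) \<le> f y - (\<Sum>x\<in>Z. u x y)" using v2 y by (auto simp: f'_def)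
      moreover have "(\<Sum>x\<in>Z. v1 x y) \<le> (\<Sum>x\<in>Z. u x y)" using v1 y by (auto intro: sum_mono)
      moreover have "(\<Sum>x\<in>Z. v1 x y) \<le> f y" using v1 y by auto
      ultimately show ?thesis by linarith
    qed
    then show ?thesis using v1 v2 by (intro exI[of _ v]) (auto simp: v_def)
  next
    case False
    show ?thesis
    proof (cases "sum b X = 0")
      case True
      then show ?thesis using finX by (intro exI[of _ "\<lambda>_ _. 0"]) auto
    next
      case nz: False
      then obtain x0 where x0: "x0 \<in> X" "b x0 > 0" by (metis gr0I sum.neutral)
      have "0 < (\<Sum>y\<in>Y. min (f y) (\<Sum>x\<in>{x0}. u x y))" using hall[of "{x0}"] x0 by auto
      then obtain y0 where y0: "y0 \<in> Y" "f y0 > 0" "u x0 y0 > 0"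
        using sum.neutral[of Y "\<lambda>y. min (f y) (u x0 y)"] by fastforce
      define b' where "b' x = b x - of_bool (x = x0)" for x
      define f' where "f' y = f y - of_bool (y = y0)" for y
      define u' where "u' x y = u x y - of_bool (x = x0 \<and> y = y0)" for x y
      have b': "b x = b' x + of_bool (x = x0)" for x using x0 by (auto simp: b'_def)
      have f': "f y = f' y + of_bool (y = y0)" for y using y0 by (auto simp: f'_def)
      have u': "u x y = u' x y + of_bool (x = x0 \<and> y = y0)" for x y using y0 by (auto simp: u'_def)
      have delta: "(\<Sum>x\<in>Z. of_bool (x = x0)) = (of_bool (x0 \<in> Z) :: nat)" if "finite Z" for Z
        using that by (simp add: of_bool_def)
      have deltaY: "(\<Sum>y\<in>Y. of_bool (y = y0)) = (1::nat)"
        using \<open>finite Y\<close> y0 by (simp add: of_bool_def)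
      have delta2: "(\<Sum>x\<in>Z. of_bool (x = x0 \<and> y = y0)) = (of_bool (x0 \<in> Z \<and> y = y0) :: nat)"
        if "finite Z" for Z y
        using that by (cases "y = y0") (auto simp: of_bool_def)
      have bZ: "sum b Z = sum b' Z + of_bool (x0 \<in> Z)" if "finite Z" for Z
        unfolding b' using that by (simp add: sum.distrib delta)
      have uZ: "(\<Sum>x\<in>Z. u x y) = (\<Sum>x\<in>Z. u' x y) + of_bool (x0 \<in> Z \<and> y = y0)" if "finite Z" for Z y
        unfolding u' using that by (simp only: sum.distrib delta2)
      have hall': "sum b' Z \<le> (\<Sum>y\<in>Y. min (f' y) (\<Sum>x\<in>Z. u' x y))" if Z: "Z \<subseteq> X" for Z
      proof -
        have finZ: "finite Z" using Z finX by (rule finite_subset)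
        consider "Z = {}" | "x0 \<in> Z" | "Z \<noteq> {}" "x0 \<notin> Z" by blast
        then show ?thesis
        proof cases
          case 2
          have "sum b' Z + 1 \<le> (\<Sum>y\<in>Y. min (f y) (\<Sum>x\<in>Z. u x y))"
            using hall[OF Z] bZ[OF finZ] 2 by simp
          also have "\<dots> = (\<Sum>y\<in>Y. min (f' y) (\<Sum>x\<in>Z. u' x y) + of_bool (y = y0))"
            using 2 by (intro sum.cong) (auto simp: f' uZ[OF finZ])
          finally show ?thesis by (simp only: sum.distrib deltaY add_le_cancel_right)
        next
          case 3
          \<comment> \<open>Such a \<open>Z\<close> is a proper subset, hence not tight, and the
            slack of one pays for the drop of at most one in the minimum at \<open>y0\<close>. Sets
            containing \<open>x0\<close>, including \<open>X\<close> itself, lose one on both sides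
            instead.\<close>
          then have "sum b Z \<noteq> (\<Sum>y\<in>Y. min (f y) (\<Sum>x\<in>Z. u x y))"
            using False Z x0 by blast
          then have "sum b' Z + 1 \<le> (\<Sum>y\<in>Y. min (f y) (\<Sum>x\<in>Z. u x y))"
            using hall[OF Z] bZ[OF finZ] 3 by simp
          also have "\<dots> \<le> (\<Sum>y\<in>Y. min (f' y) (\<Sum>x\<in>Z. u' x y) + of_bool (y = y0))"
            using 3 by (intro sum_mono) (auto simp: f' uZ[OF finZ])
          finally show ?thesis by (simp only: sum.distrib deltaY add_le_cancel_right)
        qed simp
      qed
      have "card X + sum b' X < card X + sum b X" using bZ[OF finX] x0 by simp
      from less.hyps[OF this finX hall'] obtain v
        where v: "\<forall>x\<in>X. \<forall>y\<in>Y. v x y \<le> u' x y" "\<forall>x\<in>X. (\<Sum>y\<in>Y. v x y) = b' x"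
          "\<forall>y\<in>Y. (\<Sum>x\<in>X. v x y) \<le> f' y" by blast
      have rows: "(\<Sum>y\<in>Y. of_bool (x = x0 \<and> y = y0)) = (of_bool (x = x0) :: nat)" for x
        using deltaY by (cases "x = x0") auto
      show ?thesis
        using v x0(1) by (intro exI[of _ "\<lambda>x y. v x y + of_bool (x = x0 \<and> y = y0)"])
          (auto simp only: sum.distrib rows delta2[OF finX] b' f' u' add_le_mono1 simp_thms)
    qed
  qed
qed

text \<open>Koenig-type edge colouring with prescribed degrees: averaging over the
  \<open>card S\<close> classes gives Hall's condition for a single class, and removing that class
  leaves the same proportions, so induction on \<open>S\<close> applies.\<close>

lemma regular_decomposition:
  fixes h :: "'a \<Rightarrow> 'b \<Rightarrow> nat"
  assumes "finite X" and "finite Y" and "finite S"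
    and "\<And>x. x \<in> X \<Longrightarrow> (\<Sum>y\<in>Y. h x y) = card S * b x"
    and "\<And>y. y \<in> Y \<Longrightarrow> (\<Sum>x\<in>X. h x y) = card S * f y"
  shows "\<exists>H. (\<forall>x\<in>X. \<forall>y\<in>Y. (\<Sum>s\<in>S. H s x y) = h x y) \<and>
           (\<forall>s\<in>S. (\<forall>x\<in>X. (\<Sum>y\<in>Y. H s x y) = b x) \<and> (\<forall>y\<in>Y. (\<Sum>x\<in>X. H s x y) = f y))"
  using assms(3,4,5)
proof (induction S arbitrary: h rule: finite_induct)
  case empty
  then show ?case using assms(1,2) by auto
next
  case (insert s S)
  define q where "q = Suc (card S)"
  have rows: "(\<Sum>y\<in>Y. h x y) = q * b x" if "x \<in> X" for x using insert that by (simp add: q_def)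
  have cols: "(\<Sum>x\<in>X. h x y) = q * f y" if "y \<in> Y" for y using insert that by (simp add: q_def)
  have hall: "sum b Z \<le> (\<Sum>y\<in>Y. min (f y) (\<Sum>x\<in>Z. h x y))" if Z: "Z \<subseteq> X" for Z
  proof -
    have "q * sum b Z = (\<Sum>x\<in>Z. \<Sum>y\<in>Y. h x y)"
      using rows Z by (auto simp: sum_distrib_left intro!: sum.cong)
    also have "\<dots> = (\<Sum>y\<in>Y. \<Sum>x\<in>Z. h x y)" by (rule sum.swap)
    \<comment> \<open>The inner sum is at most \<open>q\<close> times itself since \<open>q\<close>
      is positive, and, being part of a full column, at most \<open>q * f y\<close>.\<close>
    also have "\<dots> \<le> (\<Sum>y\<in>Y. q * min (f y) (\<Sum>x\<in>Z. h x y))"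
    proof (rule sum_mono)
      fix y assume y: "y \<in> Y"
      have "(\<Sum>x\<in>Z. h x y) \<le> (\<Sum>x\<in>X. h x y)" using Z assms(1) by (intro sum_mono2) auto
      with cols[OF y] show "(\<Sum>x\<in>Z. h x y) \<le> q * min (f y) (\<Sum>x\<in>Z. h x y)"
        by (auto simp: min_def q_def)
    qed
    finally show ?thesis by (simp add: sum_distrib_left[symmetric] q_def del: mult_Suc)
  qed
  obtain v where v: "\<forall>x\<in>X. \<forall>y\<in>Y. v x y \<le> h x y" "\<forall>x\<in>X. (\<Sum>y\<in>Y. v x y) = b x"
      "\<forall>y\<in>Y. (\<Sum>x\<in>X. v x y) \<le> f y"
    using capacitated_transport[OF assms(1,2) hall] by blast
  \<comment> \<open>Both sides count all of \<open>h\<close>. Equal totals turn the upper bounds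
    \<open>f y\<close> on the columns of \<open>v\<close> into equalities.\<close>
  have "q * sum b X = q * sum f Y"
    using rows cols sum.swap[of h Y X] by (simp add: sum_distrib_left)
  then have "(\<Sum>y\<in>Y. \<Sum>x\<in>X. v x y) = sum f Y"
    using v(2) sum.swap[of v Y X] by (simp add: q_def del: mult_Suc)
  then have vf: "(\<Sum>x\<in>X. v x y) = f y" if "y \<in> Y" for y
    using sum_mono_inv[of "\<lambda>y. \<Sum>x\<in>X. v x y" Y f] v(3) that assms(2) by blast
  define h' where "h' x y = h x y - v x y" for x y
  have h: "h x y = h' x y + v x y" if "x \<in> X" "y \<in> Y" for x y using v that by (simp add: h'_def)
  have "(\<Sum>y\<in>Y. h' x y) = card S * b x" if "x \<in> X" for x
    using rows[OF that] v(2) that h[OF that] by (simp add: sum.distrib q_def)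
  moreover have "(\<Sum>x\<in>X. h' x y) = card S * f y" if "y \<in> Y" for y
    using cols[OF that] vf[OF that] that h by (simp add: sum.distrib q_def)
  ultimately obtain H where H: "\<forall>x\<in>X. \<forall>y\<in>Y. (\<Sum>s\<in>S. H s x y) = h' x y"
    "\<forall>s\<in>S. (\<forall>x\<in>X. (\<Sum>y\<in>Y. H s x y) = b x) \<and> (\<forall>y\<in>Y. (\<Sum>x\<in>X. H s x y) = f y)"
    using insert.IH[of h'] by blast
  define H' where "H' = H(s := v)"
  have "(\<Sum>s\<in>S. H' s x y) = (\<Sum>s\<in>S. H s x y)" for x y
    using insert.hyps by (intro sum.cong) (auto simp: H'_def)
  then show ?case using insert.hyps H h v(2) vf
    by (intro exI[of _ H']) (auto simp: H'_def)
qed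

text \<open>
  All line sums are made divisible by \<open>card S\<close>: for each \<open>l\<close> a dummy column \<open>Inr l\<close> holds
  \<open>card S - a l\<close> copies of \<open>l\<close> and \<open>a l\<close> copies of a dummy symbol \<open>None\<close>.
\<close>

lemma balanced_decomposition:
  fixes h :: "'a \<Rightarrow> 'b \<Rightarrow> nat"
  assumes "finite L" and "finite I" and "finite S"
    and rows: "\<And>l. l \<in> L \<Longrightarrow> (\<Sum>i\<in>I. h l i) = card S * d l + a l"
    and cols: "\<And>i. i \<in> I \<Longrightarrow> (\<Sum>l\<in>L. h l i) = card S * m i"
    and a: "\<And>l. l \<in> L \<Longrightarrow> a l \<le> card S"
  shows "\<exists>H. (\<forall>l\<in>L. \<forall>i\<in>I. (\<Sum>s\<in>S. H s l i) = h l i) \<and>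
           (\<forall>s\<in>S. (\<forall>i\<in>I. (\<Sum>l\<in>L. H s l i) = m i) \<and>
             (\<forall>l\<in>L. d l \<le> (\<Sum>i\<in>I. H s l i) \<and> (\<Sum>i\<in>I. H s l i) \<le> d l + of_bool (a l > 0)))"
proof -
  define X where "X = insert None (Some ` L)"
  define Y :: "('b + 'a) set" where "Y = Inl ` I \<union> Inr ` L"
  define G :: "'a option \<Rightarrow> 'b + 'a \<Rightarrow> nat" where
    "G x y = (case y of
       Inl i \<Rightarrow> (case x of None \<Rightarrow> 0 | Some l \<Rightarrow> h l i)
     | Inr l' \<Rightarrow> (case x of None \<Rightarrow> a l' | Some l \<Rightarrow> if l = l' then card S - a l else 0))" for x y
  have sumX: "(\<Sum>x\<in>X. g x) = g None + (\<Sum>l\<in>L. g (Some l))" for g :: "'a option \<Rightarrow> nat"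
    using assms(1) by (simp add: X_def sum.reindex)
  have sumY: "(\<Sum>y\<in>Y. g y) = (\<Sum>i\<in>I. g (Inl i)) + (\<Sum>l\<in>L. g (Inr l))" for g :: "'b + 'a \<Rightarrow> nat"
    unfolding Y_def using assms(1,2) by (subst sum.union_disjoint) (auto simp: sum.reindex)
  \<comment> \<open>Double counting \<open>h\<close> makes the total \<open>sum a L\<close> of the
    dummy row \<open>None\<close> a multiple of \<open>card S\<close>.\<close>
  have "card S * sum m I = (\<Sum>l\<in>L. \<Sum>i\<in>I. h l i)"
    using cols sum.swap[of h I L] by (simp add: sum_distrib_left)
  also have "\<dots> = card S * sum d L + sum a L"
    using rows by (simp add: sum.distrib sum_distrib_left)
  finally have "sum a L = card S * (sum m I - sum d L)" by (simp add: diff_mult_distrib2)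
  moreover define B where "B x = (case x of None \<Rightarrow> sum m I - sum d L | Some l \<Rightarrow> d l + 1)" for x
  ultimately have B: "(\<Sum>y\<in>Y. G x y) = card S * B x" if "x \<in> X" for x
    using that rows a assms(1) by (auto simp: X_def sumY G_def)
  define F where "F y = (case y of Inl i \<Rightarrow> m i | Inr _ \<Rightarrow> 1)" for y :: "'b + 'a"
  have F: "(\<Sum>x\<in>X. G x y) = card S * F y" if "y \<in> Y" for y
    using that cols a assms(1) by (auto simp: Y_def sumX G_def F_def)
  have fin: "finite X" "finite Y" using assms by (auto simp: X_def Y_def)
  obtain H where H: "\<And>x y. x\<in>X \<Longrightarrow> y\<in>Y \<Longrightarrow> (\<Sum>s\<in>S. H s x y) = G x y"
    and HB: "\<And>s x. s \<in> S \<Longrightarrow> x \<in> X \<Longrightarrow> (\<Sum>y\<in>Y. H s x y) = B x"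
    and HF: "\<And>s y. s \<in> S \<Longrightarrow> y \<in> Y \<Longrightarrow> (\<Sum>x\<in>X. H s x y) = F y"
    using regular_decomposition[OF fin assms(3) B F] by blast
  have le: "H s x y \<le> G x y" if "s \<in> S" "x \<in> X" "y \<in> Y" for s x y
    using H[OF that(2,3)] member_le_sum[of s S "\<lambda>s. H s x y"] that assms(3) by simp
  have memX: "None \<in> X" "\<And>l. l \<in> L \<Longrightarrow> Some l \<in> X"
    and memY: "\<And>i. i \<in> I \<Longrightarrow> Inl i \<in> Y" "\<And>l. l \<in> L \<Longrightarrow> Inr l \<in> Y" by (auto simp: X_def Y_def)
  have offdiag: "H s (Some l) (Inr l') = 0" if "s \<in> S" "l \<in> L" "l' \<in> L" "l \<noteq> l'" for s l l'
    using le[OF that(1) memX(2)[OF that(2)] memY(2)[OF that(3)]] that by (simp add: G_def)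
  show ?thesis
  proof (intro exI[of _ "\<lambda>s l i. H s (Some l) (Inl i)"] conjI ballI)
    fix l i assume "l \<in> L" "i \<in> I"
    then show "(\<Sum>s\<in>S. H s (Some l) (Inl i)) = h l i" using H memX memY by (simp add: G_def)
  next
    fix s i assume s: "s \<in> S" and i: "i \<in> I"
    have "H s None (Inl i) = 0" using le[OF s memX(1) memY(1)[OF i]] by (simp add: G_def)
    then show "(\<Sum>l\<in>L. H s (Some l) (Inl i)) = m i"
      using HF[OF s memY(1)[OF i]] by (simp add: sumX F_def)
  next
    fix s l assume s: "s \<in> S" and l: "l \<in> L"
    have diag: "(\<Sum>l'\<in>L. g l') = g l" if "\<And>l'. l' \<in> L \<Longrightarrow> l' \<noteq> l \<Longrightarrow> g l' = 0" for g :: "'a \<Rightarrow> nat"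
      using that l assms(1) by (simp add: sum.mono_neutral_right[of L "{l}"])
    have "(\<Sum>l'\<in>L. H s (Some l) (Inr l')) = H s (Some l) (Inr l)"
      using offdiag s l by (intro diag) auto
    then have row: "(\<Sum>i\<in>I. H s (Some l) (Inl i)) + H s (Some l) (Inr l) = d l + 1"
      using HB[OF s memX(2)[OF l]] by (simp add: sumY B_def)
    have "(\<Sum>l'\<in>L. H s (Some l') (Inr l)) = H s (Some l) (Inr l)"
      using offdiag s l by (intro diag) auto
    \<comment> \<open>Each class holds one unit of the dummy column of \<open>l\<close>. With
      \<open>row\<close>, it has \<open>d l\<close> genuine copies of \<open>l\<close>, and one more
      exactly when that unit is \<open>None\<close>, which requires \<open>a l > 0\<close>.\<close>
    then have col: "H s None (Inr l) + H s (Some l) (Inr l) = 1"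
      using HF[OF s memY(2)[OF l]] by (simp add: sumX F_def)
    show "d l \<le> (\<Sum>i\<in>I. H s (Some l) (Inl i))" using row col by linarith
    have "H s None (Inr l) \<le> a l" using le[OF s memX(1) memY(2)[OF l]] by (simp add: G_def)
    then show "(\<Sum>i\<in>I. H s (Some l) (Inl i)) \<le> d l + of_bool (a l > 0)"
      using row col by auto
  qed
qed

section \<open>Rounding, occurrence counts and saturation\<close>

text \<open>The ceiling of \<open>m / n\<close> for positive \<open>n\<close>, written so that its
  excess over the floor is the indicator of a free symbol.\<close>

definition ceil_div :: "nat \<Rightarrow> nat \<Rightarrow> nat" where
  "ceil_div m n = m div n + of_bool (\<not> n dvd m)"

lemma rho_floor_eq: "rho_floor n \<rho> l = int (\<rho> l div n)"
  by (simp add: rho_floor_def floor_divide_of_nat_eq)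

lemma rho_ceil_eq:
  assumes "n > 0"
  shows "rho_ceil n \<rho> l = int (ceil_div (\<rho> l) n)"
proof -
  have "real (\<rho> l) = real (\<rho> l div n) * real n + real (\<rho> l mod n)"
    by (metis div_mult_mod_eq of_nat_add of_nat_mult)
  then have eq: "real (\<rho> l) / real n = real (\<rho> l div n) + real (\<rho> l mod n) / real n"
    using assms by (simp add: field_simps)
  have "0 \<le> real (\<rho> l mod n) / real n" "real (\<rho> l mod n) / real n < 1"
    "n dvd \<rho> l \<Longrightarrow> \<rho> l mod n = 0" "\<not> n dvd \<rho> l \<Longrightarrow> 0 < real (\<rho> l mod n) / real n"
    using assms by (auto simp: dvd_eq_mod_eq_0)
  then show ?thesis
    unfolding rho_ceil_def eq ceil_div_def
    by (intro ceiling_unique) (auto simp: of_bool_def simp del: zero_less_divide_iff of_nat_0_less_iff)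
qed

lemma le_mult_ceil_div:
  assumes "n > 0"
  shows "m \<le> n * ceil_div m n"
proof (cases "n dvd m")
  case False
  have "m = n * (m div n) + m mod n" by simp
  also have "\<dots> \<le> n * (m div n) + n" using mod_less_divisor[OF assms, of m] by linarith
  finally show ?thesis using False by (simp add: ceil_div_def)
qed (simp add: ceil_div_def)

lemma row_occ_eq_sum: "row_occ r2 M i l = (\<Sum>j\<in>{1..r2}. of_bool (M i j = l))"
  by (simp add: row_occ_def Int_def)

lemma col_occ_eq_sum: "col_occ r1 M j l = (\<Sum>i\<in>{1..r1}. of_bool (M i j = l))"
  by (simp add: col_occ_def Int_def)

lemma occ_eq_sum_row_occ: "occ r1 r2 M l = (\<Sum>i\<in>{1..r1}. row_occ r2 M i l)"
proof -
  have "{(i, j). i \<in> {1..r1} \<and> j \<in> {1..r2} \<and> M i j = l} =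
      Sigma {1..r1} (\<lambda>i. {j \<in> {1..r2}. M i j = l})" by auto
  then show ?thesis by (simp add: occ_def row_occ_def)
qed

lemma occ_eq_sum_col_occ: "occ r1 r2 M l = (\<Sum>j\<in>{1..r2}. col_occ r1 M j l)"
  unfolding occ_eq_sum_row_occ row_occ_eq_sum col_occ_eq_sum by (rule sum.swap)

lemma sum_split_at:
  fixes g :: "nat \<Rightarrow> 'a::comm_monoid_add"
  assumes "r \<le> n"
  shows "(\<Sum>i\<in>{1..n}. g i) = (\<Sum>i\<in>{1..r}. g i) + (\<Sum>i\<in>{r<..n}. g i)"
proof -
  have "{1..n} = {1..r} \<union> {r<..n}" using assms by auto
  then show ?thesis by (simp only:) (rule sum.union_disjoint, auto)
qed

text \<open>Since occurrences never exceed the ceiling, unsaturated means strictly below it. The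
  indicators serve as unit capacities between lines and symbols.\<close>

lemma eta_eq_sum:
  assumes "n > 0" and "finite Z"
    and "\<And>x. x \<in> Z \<Longrightarrow> line_occ r1 r2 M t x l \<le> ceil_div (\<rho> l) n"
  shows "eta n \<rho> r1 r2 M t Z l =
    (\<Sum>x\<in>Z. of_bool (\<not> n dvd \<rho> l \<and> line_occ r1 r2 M t x l < ceil_div (\<rho> l) n))"
proof (cases "n dvd \<rho> l")
  case False
  have "{x \<in> Z. \<not> saturated n \<rho> r1 r2 M t x l} =
      Z \<inter> {x. line_occ r1 r2 M t x l < ceil_div (\<rho> l) n}"
    using assms(3) by (force simp: saturated_def rho_ceil_eq[OF assms(1)])
  then show ?thesis using False assms(2) by (simp add: eta_def free_symbol_def)
qed (simp add: eta_def free_symbol_def)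

section \<open>Contents of the lines: from Hall's condition and back\<close>

text \<open>Here \<open>w x l\<close> is the number of copies of \<open>l\<close> in the completed
  line \<open>x\<close>. With ceilings everywhere, every line is overfull by the same amount
  \<open>b\<close>; a transport with unit capacities selects the symbols to be lowered by one, and
  \<open>hall\<close> is its Hall condition.\<close>

lemma line_contents_exist:
  fixes \<rho> :: "nat \<Rightarrow> nat" and n k r1 r2 t :: nat
  defines "r \<equiv> num_lines r1 r2 t" and "d \<equiv> \<lambda>l. \<rho> l div n" and "c \<equiv> \<lambda>l. ceil_div (\<rho> l) n"
  assumes n: "n > 0" and r: "r \<le> n" and total: "(\<Sum>l\<in>{1..k}. \<rho> l) = n\<^sup>2"
    and occ_le: "\<And>x l. x \<in> {1..r} \<Longrightarrow> l \<in> {1..k} \<Longrightarrow> line_occ r1 r2 M t x l \<le> c l"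
    and f_nonneg: "\<And>l. l \<in> {1..k} \<Longrightarrow> 0 \<le> f_val n \<rho> r1 r2 a t l"
    and sum_a: "(\<Sum>l\<in>{1..k}. int (a l t)) = (int n - int r) * (int n - (\<Sum>l\<in>{1..k}. rho_floor n \<rho> l))"
    and hall: "\<And>Z. Z \<subseteq> {1..r} \<Longrightarrow> (\<Sum>l\<in>{1..k}. int (card Z) * rho_ceil n \<rho> l
        - min (f_val n \<rho> r1 r2 a t l) (int (eta n \<rho> r1 r2 M t Z l))) \<le> int n * int (card Z)"
  shows "\<exists>w. (\<forall>x\<in>{1..r}. \<forall>l\<in>{1..k}. line_occ r1 r2 M t x l \<le> w x l \<and> d l \<le> w x l \<and> w x l \<le> c l) \<and>
    (\<forall>x\<in>{1..r}. (\<Sum>l\<in>{1..k}. w x l) = n) \<and>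
    (\<forall>l\<in>{1..k}. (\<Sum>x\<in>{1..r}. w x l) + ((n - r) * d l + a l t) = \<rho> l)"
proof -
  define F where "F l = nat (f_val n \<rho> r1 r2 a t l)" for l
  define u :: "nat \<Rightarrow> nat \<Rightarrow> nat" where
    "u x l = of_bool (\<not> n dvd \<rho> l \<and> line_occ r1 r2 M t x l < c l)" for x l
  define b where "b = (\<Sum>l\<in>{1..k}. c l) - n"
  have F: "int (F l) = f_val n \<rho> r1 r2 a t l" if "l \<in> {1..k}" for l
    using f_nonneg[OF that] by (simp add: F_def)
  have F_eq: "int (F l) = int r * int (c l) + (int n - int r) * int (d l) - int (\<rho> l) + int (a l t)"
    if "l \<in> {1..k}" for l
    using F[OF that] by (simp add: f_val_def r_def c_def d_def rho_floor_eq rho_ceil_eq[OF n])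
  \<comment> \<open>The ceilings of a line thus sum to at least \<open>n\<close>, so the truncated
    difference \<open>b\<close> is exact.\<close>
  have "n * n \<le> n * (\<Sum>l\<in>{1..k}. c l)"
    unfolding power2_eq_square[symmetric] total[symmetric] sum_distrib_left c_def
    by (intro sum_mono le_mult_ceil_div n)
  then have nb: "(\<Sum>l\<in>{1..k}. c l) = n + b" using n by (simp add: b_def)
  have eta: "eta n \<rho> r1 r2 M t Z l = (\<Sum>x\<in>Z. u x l)" if "Z \<subseteq> {1..r}" "l \<in> {1..k}" for Z l
    unfolding u_def c_def using that occ_le
    by (intro eta_eq_sum n) (auto simp: c_def intro: finite_subset)
  have cond: "(\<Sum>x\<in>Z. b) \<le> (\<Sum>l\<in>{1..k}. min (F l) (\<Sum>x\<in>Z. u x l))" if Z: "Z \<subseteq> {1..r}" for Z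
  proof -
    have "(\<Sum>l\<in>{1..k}. int (card Z) * rho_ceil n \<rho> l
        - min (f_val n \<rho> r1 r2 a t l) (int (eta n \<rho> r1 r2 M t Z l))) =
      (\<Sum>l\<in>{1..k}. int (card Z) * int (c l) - int (min (F l) (\<Sum>x\<in>Z. u x l)))"
      using F eta[OF Z] by (intro sum.cong) (simp_all only: rho_ceil_eq[OF n] c_def of_nat_min)
    also have "\<dots> = int (card Z) * int (n + b) - int (\<Sum>l\<in>{1..k}. min (F l) (\<Sum>x\<in>Z. u x l))"
      unfolding nb[symmetric] by (simp only: sum_subtractf sum_distrib_left of_nat_sum)
    finally have "int (card Z) * int (n + b) - int (\<Sum>l\<in>{1..k}. min (F l) (\<Sum>x\<in>Z. u x l))
        \<le> int n * int (card Z)"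
      using hall[OF Z] by simp
    then have "int (card Z * b) \<le> int (\<Sum>l\<in>{1..k}. min (F l) (\<Sum>x\<in>Z. u x l))"
      by (simp add: algebra_simps)
    then show ?thesis by (simp only: of_nat_le_iff sum_constant of_nat_id)
  qed
  obtain v where v: "\<forall>x\<in>{1..r}. \<forall>l\<in>{1..k}. v x l \<le> u x l" "\<forall>x\<in>{1..r}. (\<Sum>l\<in>{1..k}. v x l) = b"
      "\<forall>l\<in>{1..k}. (\<Sum>x\<in>{1..r}. v x l) \<le> F l"
    using capacitated_transport[of "{1..r}" "{1..k}" "\<lambda>_. b" F u] cond by blast
  \<comment> \<open>By \<open>sum_a\<close> the total capacity equals the total demand
    \<open>r * b\<close>, so each symbol is lowered in exactly \<open>F l\<close> lines.\<close>
  have "int (\<Sum>l\<in>{1..k}. F l) = (\<Sum>l\<in>{1..k}. int r * int (c l) + (int n - int r) * int (d l) - int (\<rho> l) + int (a l t))"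
    unfolding of_nat_sum using F_eq by (intro sum.cong) auto
  also have "\<dots> = int r * int (\<Sum>l\<in>{1..k}. c l) + (int n - int r) * int (\<Sum>l\<in>{1..k}. d l) - int (\<Sum>l\<in>{1..k}. \<rho> l) + (\<Sum>l\<in>{1..k}. int (a l t))"
    by (simp only: sum.distrib sum_subtractf sum_distrib_left of_nat_sum)
  also have "\<dots> = int (r * b)"
    unfolding total nb sum_a by (simp add: rho_floor_eq d_def algebra_simps power2_eq_square)
  finally have "(\<Sum>l\<in>{1..k}. F l) = r * b" by (simp only: of_nat_eq_iff)
  moreover have "(\<Sum>l\<in>{1..k}. \<Sum>x\<in>{1..r}. v x l) = r * b"
    using v(2) by (subst sum.swap) simp
  ultimately have vF: "(\<Sum>x\<in>{1..r}. v x l) = F l" if "l \<in> {1..k}" for l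
    using sum_mono_inv[of "\<lambda>l. \<Sum>x\<in>{1..r}. v x l" "{1..k}" F l] v(3) that by auto
  define w where "w x l = c l - v x l" for x l
  \<comment> \<open>Lowering by one requires a free symbol, whose ceiling is its floor plus one, and
    a line with fewer than \<open>c l\<close> copies so far; neither lower bound on
    \<open>w x l\<close> is violated.\<close>
  have wprops: "w x l + v x l = c l \<and> line_occ r1 r2 M t x l \<le> w x l \<and> d l \<le> w x l \<and> w x l \<le> c l"
    if "x \<in> {1..r}" "l \<in> {1..k}" for x l
  proof -
    have "v x l \<le> u x l" using v(1) that by blast
    then show ?thesis using occ_le[OF that]
      by (auto simp: u_def w_def c_def d_def ceil_div_def of_bool_def split: if_splits)
  qed
  have "(\<Sum>l\<in>{1..k}. w x l) = n" if x: "x \<in> {1..r}" for x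
  proof -
    have "(\<Sum>l\<in>{1..k}. w x l) + (\<Sum>l\<in>{1..k}. v x l) = (\<Sum>l\<in>{1..k}. c l)"
      using wprops[OF x] by (simp add: sum.distrib[symmetric])
    then show ?thesis using nb v(2) x by simp
  qed
  moreover have "(\<Sum>x\<in>{1..r}. w x l) + ((n - r) * d l + a l t) = \<rho> l" if l: "l \<in> {1..k}" for l
  proof -
    have "(\<Sum>x\<in>{1..r}. w x l) + (\<Sum>x\<in>{1..r}. v x l) = (\<Sum>x\<in>{1..r}. c l)"
      using wprops[OF _ l] by (simp add: sum.distrib[symmetric])
    then have "(\<Sum>x\<in>{1..r}. w x l) + F l = r * c l" using vF[OF l] by simp
    then have "int (\<Sum>x\<in>{1..r}. w x l) + int (F l) = int r * int (c l)"
      by (metis of_nat_add of_nat_mult)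
    then have "int ((\<Sum>x\<in>{1..r}. w x l) + ((n - r) * d l + a l t)) = int (\<rho> l)"
      unfolding F_eq[OF l] using r by (simp add: of_nat_diff)
    then show ?thesis by (simp only: of_nat_eq_iff)
  qed
  ultimately show ?thesis using wprops by (intro exI[of _ w]) blast
qed

text \<open>With \<open>w\<close> the contents of all \<open>n\<close> full lines, the shortfall
  \<open>c l - w x l\<close> is 0 or 1, and \<open>f_val\<close> is the total shortfall in the old
  lines. The upper bound on \<open>a l t\<close> and the inequality for \<open>Z\<close> then come
  from comparing shortfalls with unsaturated lines.\<close>

lemma line_contents_feasible:
  fixes \<rho> :: "nat \<Rightarrow> nat" and n k r1 r2 t :: nat
  defines "r \<equiv> num_lines r1 r2 t" and "d \<equiv> \<lambda>l. \<rho> l div n" and "c \<equiv> \<lambda>l. ceil_div (\<rho> l) n"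
  assumes n: "n > 0" and r: "r \<le> n"
    and occ_le: "\<And>x l. x \<in> {1..r} \<Longrightarrow> l \<in> {1..k} \<Longrightarrow> line_occ r1 r2 M t x l \<le> w x l"
    and w: "\<And>x l. x \<in> {1..n} \<Longrightarrow> l \<in> {1..k} \<Longrightarrow> d l \<le> w x l \<and> w x l \<le> c l"
    and sum_w: "\<And>x. x \<in> {1..n} \<Longrightarrow> (\<Sum>l\<in>{1..k}. w x l) = n"
    and sum_w': "\<And>l. l \<in> {1..k} \<Longrightarrow> (\<Sum>x\<in>{1..n}. w x l) = \<rho> l"
    and a: "\<And>l. l \<in> {1..k} \<Longrightarrow> (\<Sum>x\<in>{r<..n}. w x l) = (n - r) * d l + a l t"
  shows "(\<forall>l\<in>{1..k}.
      int (a l t) \<ge> int (\<rho> l) - int r * rho_ceil n \<rho> l - (int n - int r) * rho_floor n \<rho> l \<and>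
      int (a l t) \<le> min (int n * rho_ceil n \<rho> l) (int (\<rho> l) + int (eta n \<rho> r1 r2 M t {1..r} l))
        - int r * rho_ceil n \<rho> l - (int n - int r) * rho_floor n \<rho> l) \<and>
    (\<Sum>l\<in>{1..k}. int (a l t)) = (int n - int r) * (int n - (\<Sum>l\<in>{1..k}. rho_floor n \<rho> l)) \<and>
    (\<forall>Z. Z \<subseteq> {1..r} \<longrightarrow> (\<Sum>l\<in>{1..k}. int (card Z) * rho_ceil n \<rho> l
        - min (f_val n \<rho> r1 r2 a t l) (int (eta n \<rho> r1 r2 M t Z l))) \<le> int n * int (card Z))"
proof -
  define v where "v x l = c l - w x l" for x l
  have v: "c l = w x l + v x l" if "x \<in> {1..n}" "l \<in> {1..k}" for x l
    using w[OF that] by (simp add: v_def)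
  have vZ: "card Z * c l = (\<Sum>x\<in>Z. w x l) + (\<Sum>x\<in>Z. v x l)" if "Z \<subseteq> {1..r}" "l \<in> {1..k}" for Z l
  proof -
    have "card Z * c l = (\<Sum>x\<in>Z. c l)" by simp
    also have "\<dots> = (\<Sum>x\<in>Z. w x l + v x l)" using that r by (intro sum.cong v) auto
    finally show ?thesis by (simp add: sum.distrib)
  qed
  have \<rho>: "\<rho> l = (\<Sum>x\<in>{1..r}. w x l) + (n - r) * d l + a l t" if "l \<in> {1..k}" for l
    using sum_w'[OF that] sum_split_at[OF r, of "\<lambda>x. w x l"] a[OF that] by simp
  have f: "f_val n \<rho> r1 r2 a t l = int (\<Sum>x\<in>{1..r}. v x l)" if "l \<in> {1..k}" for l
  proof -
    have "int r * int (c l) = int (\<Sum>x\<in>{1..r}. w x l) + int (\<Sum>x\<in>{1..r}. v x l)"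
      using vZ[OF subset_refl that] by (metis of_nat_add of_nat_mult card_atLeastAtMost diff_Suc_1)
    moreover have "int (\<rho> l) = int (\<Sum>x\<in>{1..r}. w x l) + (int n - int r) * int (d l) + int (a l t)"
      unfolding \<rho>[OF that] using r by (simp add: of_nat_diff)
    ultimately show ?thesis
      by (simp add: f_val_def rho_floor_eq rho_ceil_eq[OF n] r_def[symmetric] c_def d_def)
  qed
  have occ_le_c: "line_occ r1 r2 M t x l \<le> c l" if "x \<in> {1..r}" "l \<in> {1..k}" for x l
    using occ_le[OF that] w[of x l] that r by fastforce
  have eta: "(\<Sum>x\<in>Z. v x l) \<le> eta n \<rho> r1 r2 M t Z l" if Z: "Z \<subseteq> {1..r}" and l: "l \<in> {1..k}" for Z l
  proof -
    have "eta n \<rho> r1 r2 M t Z l = (\<Sum>x\<in>Z. of_bool (\<not> n dvd \<rho> l \<and> line_occ r1 r2 M t x l < c l))"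
      unfolding c_def using Z l occ_le_c
      by (intro eta_eq_sum n) (auto simp: c_def intro: finite_subset)
    \<comment> \<open>A positive shortfall forces floor and ceiling to differ, and the given part of
      the line holds at most \<open>w x l < c l\<close> copies.\<close>
    moreover have "v x l \<le> of_bool (\<not> n dvd \<rho> l \<and> line_occ r1 r2 M t x l < c l)" if "x \<in> Z" for x
      using w[of x l] occ_le[of x l] that Z l r
      by (force simp: v_def c_def d_def ceil_div_def of_bool_def split: if_splits)
    ultimately show ?thesis by (simp only: sum_mono)
  qed
  have a_le: "int (a l t) \<le> (int n - int r) * (int (c l) - int (d l))" if l: "l \<in> {1..k}" for l
  proof -
    have "(n - r) * d l + a l t \<le> (\<Sum>x\<in>{r<..n}. c l)"
      unfolding a[OF l, symmetric] using w l by (intro sum_mono) auto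
    then have "int ((n - r) * d l + a l t) \<le> int ((n - r) * c l)"
      by (simp only: of_nat_le_iff sum_constant card_greaterThanAtMost of_nat_id)
    then have "(int n - int r) * int (d l) + int (a l t) \<le> (int n - int r) * int (c l)"
      using r by (simp only: of_nat_add of_nat_mult of_nat_diff)
    then show ?thesis by (simp add: algebra_simps)
  qed
  have bounds: "int (a l t) \<ge> int (\<rho> l) - int r * rho_ceil n \<rho> l - (int n - int r) * rho_floor n \<rho> l \<and>
      int (a l t) \<le> min (int n * rho_ceil n \<rho> l) (int (\<rho> l) + int (eta n \<rho> r1 r2 M t {1..r} l))
        - int r * rho_ceil n \<rho> l - (int n - int r) * rho_floor n \<rho> l" if l: "l \<in> {1..k}" for l
  proof -
    have "0 \<le> f_val n \<rho> r1 r2 a t l" "f_val n \<rho> r1 r2 a t l \<le> int (eta n \<rho> r1 r2 M t {1..r} l)"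
      unfolding f[OF l] using eta[OF subset_refl l] by (simp_all only: of_nat_le_iff of_nat_0_le_iff)
    then show ?thesis
      using a_le[OF l]
      by (simp add: f_val_def r_def[symmetric] rho_floor_eq rho_ceil_eq[OF n] c_def d_def algebra_simps)
  qed
  have "(\<Sum>l\<in>{1..k}. (n - r) * d l + a l t) = (\<Sum>x\<in>{r<..n}. \<Sum>l\<in>{1..k}. w x l)"
    using a by (subst sum.swap) simp
  also have "\<dots> = (n - r) * n" using sum_w by simp
  finally have "int ((n - r) * (\<Sum>l\<in>{1..k}. d l) + (\<Sum>l\<in>{1..k}. a l t)) = int ((n - r) * n)"
    by (simp only: sum.distrib sum_distrib_left)
  then have "(int n - int r) * (\<Sum>l\<in>{1..k}. int (d l)) + (\<Sum>l\<in>{1..k}. int (a l t)) = (int n - int r) * int n"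
    using r by (simp only: of_nat_add of_nat_mult of_nat_diff of_nat_sum)
  then have sum_a: "(\<Sum>l\<in>{1..k}. int (a l t)) = (int n - int r) * (int n - (\<Sum>l\<in>{1..k}. rho_floor n \<rho> l))"
    by (simp add: rho_floor_eq d_def algebra_simps)
  have "(\<Sum>l\<in>{1..k}. int (card Z) * rho_ceil n \<rho> l
        - min (f_val n \<rho> r1 r2 a t l) (int (eta n \<rho> r1 r2 M t Z l))) \<le> int n * int (card Z)"
    if Z: "Z \<subseteq> {1..r}" for Z
  proof -
    have "(\<Sum>l\<in>{1..k}. int (card Z) * rho_ceil n \<rho> l
        - min (f_val n \<rho> r1 r2 a t l) (int (eta n \<rho> r1 r2 M t Z l))) \<le> (\<Sum>l\<in>{1..k}. int (\<Sum>x\<in>Z. w x l))"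
    proof (rule sum_mono)
      fix l assume l: "l \<in> {1..k}"
      \<comment> \<open>The shortfall on \<open>Z\<close> is below both arguments of the minimum;
        subtracting it instead can only enlarge the term, which becomes the content of
        \<open>Z\<close>.\<close>
      have "(\<Sum>x\<in>Z. v x l) \<le> (\<Sum>x\<in>{1..r}. v x l)" using Z by (intro sum_mono2) auto
      then have "int (\<Sum>x\<in>Z. v x l) \<le> min (f_val n \<rho> r1 r2 a t l) (int (eta n \<rho> r1 r2 M t Z l))"
        unfolding f[OF l] using eta[OF Z l] by linarith
      moreover have "int (card Z) * rho_ceil n \<rho> l = int (\<Sum>x\<in>Z. w x l) + int (\<Sum>x\<in>Z. v x l)"
        using vZ[OF Z l] unfolding rho_ceil_eq[OF n] c_def by (metis of_nat_add of_nat_mult)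
      ultimately show "int (card Z) * rho_ceil n \<rho> l
        - min (f_val n \<rho> r1 r2 a t l) (int (eta n \<rho> r1 r2 M t Z l)) \<le> int (\<Sum>x\<in>Z. w x l)" by linarith
    qed
    also have "\<dots> = int (\<Sum>x\<in>Z. \<Sum>l\<in>{1..k}. w x l)"
      unfolding of_nat_sum by (rule sum.swap)
    also have "(\<Sum>x\<in>Z. \<Sum>l\<in>{1..k}. w x l) = (\<Sum>x\<in>Z. n)"
      using Z r by (intro sum.cong sum_w) auto
    finally show ?thesis by (simp add: mult.commute)
  qed
  with bounds sum_a show ?thesis by blast
qed

section \<open>Construction of the extension\<close>

text \<open>Reads off the symbol of a cell from multiplicities with total one.\<close>

lemma sum_eq_1_imp_unit:
  fixes p :: "'a \<Rightarrow> nat"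
  assumes "finite L" and "sum p L = 1"
  shows "\<exists>x. x \<in> L \<and> (\<forall>l\<in>L. p l = of_bool (x = l))"
proof -
  obtain x where "x \<in> L" "p x = 1" "\<forall>l\<in>L. x \<noteq> l \<longrightarrow> p l = 0"
    using sum_eq_1_iff[OF assms(1), of p] assms(2) by auto
  then show ?thesis by (intro exI[of _ x]) (auto simp: of_bool_def)
qed

lemma sum_row_occ:
  assumes "is_array k r1 r2 M" and "i \<in> {1..r1}"
  shows "(\<Sum>l\<in>{1..k}. row_occ r2 M i l) = r2"
proof -
  have "(\<Sum>l\<in>{1..k}. row_occ r2 M i l) = (\<Sum>j\<in>{1..r2}. \<Sum>l\<in>{1..k}. of_bool (M i j = l))"
    unfolding row_occ_eq_sum by (rule sum.swap)
  also have "\<dots> = (\<Sum>j\<in>{1..r2}. 1)"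
    using assms by (intro sum.cong) (auto simp: is_array_def of_bool_def)
  finally show ?thesis by simp
qed

lemma sum_col_occ:
  assumes "is_array k r1 r2 M" and "j \<in> {1..r2}"
  shows "(\<Sum>l\<in>{1..k}. col_occ r1 M j l) = r1"
proof -
  have "(\<Sum>l\<in>{1..k}. col_occ r1 M j l) = (\<Sum>i\<in>{1..r1}. \<Sum>l\<in>{1..k}. of_bool (M i j = l))"
    unfolding col_occ_eq_sum by (rule sum.swap)
  also have "\<dots> = (\<Sum>i\<in>{1..r1}. 1)"
    using assms by (intro sum.cong) (auto simp: is_array_def of_bool_def)
  finally show ?thesis by simp
qed

text \<open>
  Row \<open>i\<close> of the extension contains \<open>w1 i l\<close> copies of \<open>l\<close>, and column \<open>j\<close> contains \<open>w2 j l\<close>.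
  The new rows are built first, with all new columns merged into a column \<open>0\<close> of width \<open>n - r2\<close>
  whose part in the new rows holds \<open>e l\<close> copies of \<open>l\<close>; then the merged column is split.
\<close>

lemma extension_exists:
  fixes M :: array and \<rho> a1 a2 :: "nat \<Rightarrow> nat" and w1 w2 :: "nat \<Rightarrow> nat \<Rightarrow> nat" and n k r1 r2 :: nat
  defines "d \<equiv> \<lambda>l. \<rho> l div n" and "c \<equiv> \<lambda>l. ceil_div (\<rho> l) n"
  assumes n: "n > 0" and r1: "r1 \<le> n" and r2: "r2 \<le> n" and M: "is_array k r1 r2 M"
    and w1: "\<And>i l. i \<in> {1..r1} \<Longrightarrow> l \<in> {1..k} \<Longrightarrow> row_occ r2 M i l \<le> w1 i l \<and> d l \<le> w1 i l \<and> w1 i l \<le> c l"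
    and sum_w1: "\<And>i. i \<in> {1..r1} \<Longrightarrow> (\<Sum>l\<in>{1..k}. w1 i l) = n"
    and sum_w1': "\<And>l. l \<in> {1..k} \<Longrightarrow> (\<Sum>i\<in>{1..r1}. w1 i l) + ((n - r1) * d l + a1 l) = \<rho> l"
    and w2: "\<And>j l. j \<in> {1..r2} \<Longrightarrow> l \<in> {1..k} \<Longrightarrow> col_occ r1 M j l \<le> w2 j l \<and> d l \<le> w2 j l \<and> w2 j l \<le> c l"
    and sum_w2: "\<And>j. j \<in> {1..r2} \<Longrightarrow> (\<Sum>l\<in>{1..k}. w2 j l) = n"
    and sum_w2': "\<And>l. l \<in> {1..k} \<Longrightarrow> (\<Sum>j\<in>{1..r2}. w2 j l) + ((n - r2) * d l + a2 l) = \<rho> l"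
    and a1: "\<And>l. l \<in> {1..k} \<Longrightarrow> a1 l \<le> n - r1 \<and> (n dvd \<rho> l \<longrightarrow> a1 l = 0)"
    and a2: "\<And>l. l \<in> {1..k} \<Longrightarrow> a2 l \<le> n - r2 \<and> (n dvd \<rho> l \<longrightarrow> a2 l = 0)"
    and sum_a1: "(\<Sum>l\<in>{1..k}. (n - r1) * d l + a1 l) = (n - r1) * n"
    and corner: "\<And>l. l \<in> {1..k} \<Longrightarrow>
      \<rho> l \<le> occ r1 r2 M l + ((n - r1) * d l + a1 l) + ((n - r2) * d l + a2 l)"
  shows "\<exists>N. equitable_latin_square n k \<rho> N \<and> extends_to r1 r2 M N"
proof -
  \<comment> \<open>Inclusion-exclusion: old cells, new rows and new columns cover the square with
    the corner counted twice. The hypothesis \<open>corner\<close> makes the truncated difference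
    exact.\<close>
  define e where "e l = occ r1 r2 M l + ((n - r1) * d l + a1 l) + ((n - r2) * d l + a2 l) - \<rho> l" for l
  have e: "\<rho> l + e l = occ r1 r2 M l + ((n - r1) * d l + a1 l) + ((n - r2) * d l + a2 l)"
    if "l \<in> {1..k}" for l using corner[OF that] by (simp add: e_def)

  define h where "h l j = (if j = 0 then e l else w2 j l - col_occ r1 M j l)" for l j
  have h: "w2 j l = col_occ r1 M j l + h l j" if "j \<in> {1..r2}" "l \<in> {1..k}" for j l
    using w2[OF that] that by (simp add: h_def)
  have sum0: "(\<Sum>j\<in>{0..r2}. g j) = g 0 + (\<Sum>j\<in>{1..r2}. g j)" for g :: "nat \<Rightarrow> nat"
    by (simp add: sum.atLeast_Suc_atMost)
  have h_row: "(\<Sum>j\<in>{0..r2}. h l j) = card {r1<..n} * d l + a1 l" if l: "l \<in> {1..k}" for l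
  proof -
    have "(\<Sum>j\<in>{1..r2}. w2 j l) = occ r1 r2 M l + (\<Sum>j\<in>{1..r2}. h l j)"
      unfolding occ_eq_sum_col_occ sum.distrib[symmetric] using l by (intro sum.cong h) auto
    then show ?thesis using sum_w2'[OF l] e[OF l] by (simp add: sum0 h_def)
  qed
  have h_col: "(\<Sum>l\<in>{1..k}. h l j) = n - r1" if j: "j \<in> {1..r2}" for j
  proof -
    have "(\<Sum>l\<in>{1..k}. w2 j l) = (\<Sum>l\<in>{1..k}. col_occ r1 M j l) + (\<Sum>l\<in>{1..k}. h l j)"
      unfolding sum.distrib[symmetric] using j by (intro sum.cong h) auto
    then show ?thesis using sum_w2[OF j] sum_col_occ[OF M j] by simp
  qed
  \<comment> \<open>The new rows have \<open>(n - r1) * n\<close> cells, of which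
    \<open>(n - r1) * r2\<close> lie in old columns; the rest is the corner.\<close>
  have h_col0: "(\<Sum>l\<in>{1..k}. h l 0) = (n - r1) * (n - r2)"
  proof -
    have "(n - r1) * n = (\<Sum>l\<in>{1..k}. \<Sum>j\<in>{0..r2}. h l j)"
      using h_row sum_a1 by simp
    also have "\<dots> = (\<Sum>l\<in>{1..k}. h l 0) + (\<Sum>l\<in>{1..k}. \<Sum>j\<in>{1..r2}. h l j)"
      by (simp only: sum0 sum.distrib)
    also have "(\<Sum>l\<in>{1..k}. \<Sum>j\<in>{1..r2}. h l j) = (\<Sum>j\<in>{1..r2}. \<Sum>l\<in>{1..k}. h l j)"
      by (rule sum.swap)
    also have "\<dots> = (n - r1) * r2" using h_col by simp
    finally show ?thesis by (simp add: diff_mult_distrib2)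
  qed
  have a1': "a1 l \<le> card {r1<..n}" if "l \<in> {1..k}" for l using a1[OF that] by simp
  have h_col': "(\<Sum>l\<in>{1..k}. h l j) = card {r1<..n} * (if j = 0 then n - r2 else 1)"
    if "j \<in> {0..r2}" for j
    using that h_col h_col0 by (cases "j = 0") auto
  obtain H where H: "\<And>l j. l \<in> {1..k} \<Longrightarrow> j \<in> {0..r2} \<Longrightarrow> (\<Sum>s\<in>{r1<..n}. H s l j) = h l j"
    and H_col: "\<And>s j. s \<in> {r1<..n} \<Longrightarrow> j \<in> {0..r2} \<Longrightarrow>
      (\<Sum>l\<in>{1..k}. H s l j) = (if j = 0 then n - r2 else 1)"
    and H_row: "\<And>s l. s \<in> {r1<..n} \<Longrightarrow> l \<in> {1..k} \<Longrightarrow>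
      d l \<le> (\<Sum>j\<in>{0..r2}. H s l j) \<and> (\<Sum>j\<in>{0..r2}. H s l j) \<le> d l + of_bool (a1 l > 0)"
    using balanced_decomposition[OF finite_atLeastAtMost finite_atLeastAtMost
        finite_greaterThanAtMost h_row h_col' a1'] by blast

  \<comment> \<open>Demand of each row in the new columns: for an old row what \<open>w1\<close>
    still lacks, for a new row the share of column \<open>0\<close> assigned by the first
    splitting.\<close>
  define g where "g l i = (if i \<le> r1 then w1 i l - row_occ r2 M i l else H i l 0)" for l i
  have g: "w1 i l = row_occ r2 M i l + g l i" if "i \<in> {1..r1}" "l \<in> {1..k}" for i l
    using w1[OF that] that by (simp add: g_def)
  have g_row: "(\<Sum>i\<in>{1..n}. g l i) = card {r2<..n} * d l + a2 l" if l: "l \<in> {1..k}" for l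
  proof -
    have "(\<Sum>i\<in>{1..r1}. w1 i l) = occ r1 r2 M l + (\<Sum>i\<in>{1..r1}. g l i)"
      unfolding occ_eq_sum_row_occ sum.distrib[symmetric] using l by (intro sum.cong g) auto
    moreover have "(\<Sum>i\<in>{r1<..n}. g l i) = e l"
      using H[OF l, of 0] by (simp add: g_def h_def)
    ultimately show ?thesis
      using sum_w1'[OF l] e[OF l] sum_split_at[OF r1, of "g l"] by simp
  qed
  have g_col: "(\<Sum>l\<in>{1..k}. g l i) = card {r2<..n} * 1" if i: "i \<in> {1..n}" for i
  proof (cases "i \<le> r1")
    case True
    then have i: "i \<in> {1..r1}" using i by simp
    have "(\<Sum>l\<in>{1..k}. w1 i l) = (\<Sum>l\<in>{1..k}. row_occ r2 M i l) + (\<Sum>l\<in>{1..k}. g l i)"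
      unfolding sum.distrib[symmetric] using i by (intro sum.cong g) auto
    then show ?thesis using sum_w1[OF i] sum_row_occ[OF M i] by simp
  next
    case False
    then show ?thesis using H_col[of i 0] i by (simp add: g_def)
  qed
  have a2': "a2 l \<le> card {r2<..n}" if "l \<in> {1..k}" for l using a2[OF that] by simp
  obtain G where G: "\<And>l i. l \<in> {1..k} \<Longrightarrow> i \<in> {1..n} \<Longrightarrow> (\<Sum>s\<in>{r2<..n}. G s l i) = g l i"
    and G_col: "\<And>s i. s \<in> {r2<..n} \<Longrightarrow> i \<in> {1..n} \<Longrightarrow> (\<Sum>l\<in>{1..k}. G s l i) = 1"
    and G_row: "\<And>s l. s \<in> {r2<..n} \<Longrightarrow> l \<in> {1..k} \<Longrightarrow>
      d l \<le> (\<Sum>i\<in>{1..n}. G s l i) \<and> (\<Sum>i\<in>{1..n}. G s l i) \<le> d l + of_bool (a2 l > 0)"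
    using balanced_decomposition[OF finite_atLeastAtMost finite_atLeastAtMost
        finite_greaterThanAtMost g_row g_col a2'] by blast

  \<comment> \<open>For \<open>j > 0\<close> the multiplicities in a cell of \<open>H\<close> sum to
    one and name a symbol; column \<open>0\<close> is left to the second splitting.\<close>
  have "\<exists>x. x \<in> {1..k} \<and> (\<forall>l\<in>{1..k}. H i l j = of_bool (x = l))"
    if "i \<in> {r1<..n}" "j \<in> {1..r2}" for i j
    using H_col[of i j] that by (intro sum_eq_1_imp_unit) auto
  then obtain P where P: "\<And>i j. i \<in> {r1<..n} \<Longrightarrow> j \<in> {1..r2} \<Longrightarrow>
      P i j \<in> {1..k} \<and> (\<forall>l\<in>{1..k}. H i l j = of_bool (P i j = l))"
    by metis
  have "\<exists>x. x \<in> {1..k} \<and> (\<forall>l\<in>{1..k}. G j l i = of_bool (x = l))"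
    if "i \<in> {1..n}" "j \<in> {r2<..n}" for i j
    using G_col[of j i] that by (intro sum_eq_1_imp_unit) auto
  then obtain Q where Q: "\<And>i j. i \<in> {1..n} \<Longrightarrow> j \<in> {r2<..n} \<Longrightarrow>
      Q i j \<in> {1..k} \<and> (\<forall>l\<in>{1..k}. G j l i = of_bool (Q i j = l))"
    by metis
  define N where "N i j = (if r2 < j then Q i j else if r1 < i then P i j else M i j)" for i j

  have array: "is_array k n n N"
    unfolding is_array_def
  proof (intro ballI)
    fix i j assume ij: "i \<in> {1..n}" "j \<in> {1..n}"
    show "N i j \<in> {1..k}"
      using Q[of i j] P[of i j] M ij by (auto simp: N_def is_array_def)
  qed
  have right: "(\<Sum>j\<in>{r2<..n}. of_bool (N i j = l)) = g l i" if "i \<in> {1..n}" "l \<in> {1..k}" for i l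
  proof -
    have "(\<Sum>j\<in>{r2<..n}. of_bool (N i j = l)) = (\<Sum>j\<in>{r2<..n}. G j l i)"
      using Q that by (intro sum.cong) (auto simp: N_def)
    then show ?thesis using G that by simp
  qed
  have row1: "row_occ n N i l = w1 i l" if i: "i \<in> {1..r1}" and l: "l \<in> {1..k}" for i l
  proof -
    have "(\<Sum>j\<in>{1..r2}. of_bool (N i j = l)) = row_occ r2 M i l"
      unfolding row_occ_eq_sum using i by (intro sum.cong) (auto simp: N_def)
    moreover have "i \<in> {1..n}" using i r1 by simp
    ultimately show ?thesis
      unfolding row_occ_eq_sum[of n] sum_split_at[OF r2] by (simp only: right l g[OF i l])
  qed
  \<comment> \<open>Splitting column \<open>0\<close> moves symbols only within a row, so the
    balance of the new rows obtained from \<open>H\<close> survives.\<close>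
  have row2: "row_occ n N i l = (\<Sum>j\<in>{0..r2}. H i l j)" if i: "i \<in> {r1<..n}" and l: "l \<in> {1..k}" for i l
  proof -
    have "(\<Sum>j\<in>{1..r2}. of_bool (N i j = l)) = (\<Sum>j\<in>{1..r2}. H i l j)"
      using P[OF i] i l by (intro sum.cong) (auto simp: N_def)
    moreover have "i \<in> {1..n}" using i by simp
    moreover have "g l i = H i l 0" using i by (simp add: g_def)
    ultimately show ?thesis
      unfolding row_occ_eq_sum[of n] sum_split_at[OF r2] sum0 by (simp only: right l add.commute)
  qed
  have col1: "col_occ n N j l = w2 j l" if j: "j \<in> {1..r2}" and l: "l \<in> {1..k}" for j l
  proof -
    have "(\<Sum>i\<in>{1..r1}. of_bool (N i j = l)) = col_occ r1 M j l"
      unfolding col_occ_eq_sum using j by (intro sum.cong) (auto simp: N_def)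
    moreover have "(\<Sum>i\<in>{r1<..n}. of_bool (N i j = l)) = (\<Sum>i\<in>{r1<..n}. H i l j)"
      using P j l by (intro sum.cong) (auto simp: N_def)
    moreover have "j \<in> {0..r2}" using j by simp
    ultimately show ?thesis
      unfolding col_occ_eq_sum[of n] sum_split_at[OF r1] by (simp only: H l h[OF j l])
  qed
  have col2: "col_occ n N j l = (\<Sum>i\<in>{1..n}. G j l i)" if j: "j \<in> {r2<..n}" and l: "l \<in> {1..k}" for j l
    unfolding col_occ_eq_sum using Q j l by (intro sum.cong) (auto simp: N_def)

  \<comment> \<open>The extra copy in a new line occurs only if \<open>a1 l\<close> or
    \<open>a2 l\<close> is positive, hence only for a free symbol.\<close>
  have dc: "d l + of_bool (a1 l > 0) \<le> c l" "d l + of_bool (a2 l > 0) \<le> c l" if "l \<in> {1..k}" for l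
    using a1[OF that] a2[OF that] by (auto simp: c_def d_def ceil_div_def)
  have rows: "d l \<le> row_occ n N i l \<and> row_occ n N i l \<le> c l" if i: "i \<in> {1..n}" and l: "l \<in> {1..k}" for i l
  proof (cases "i \<le> r1")
    case True
    then show ?thesis using i row1[of i l] w1[of i l] l by simp
  next
    case False
    then have "i \<in> {r1<..n}" using i by simp
    then show ?thesis using H_row[of i l] row2[of i l] dc(1)[OF l] l by linarith
  qed
  have cols: "d l \<le> col_occ n N j l \<and> col_occ n N j l \<le> c l" if j: "j \<in> {1..n}" and l: "l \<in> {1..k}" for j l
  proof (cases "j \<le> r2")
    case True
    then show ?thesis using j col1[of j l] w2[of j l] l by simp
  next
    case False
    then have "j \<in> {r2<..n}" using j by simp
    then show ?thesis using G_row[of j l] col2[of j l] dc(2)[OF l] l by linarith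
  qed
  have total: "occ n n N l = \<rho> l" if l: "l \<in> {1..k}" for l
  proof -
    have "(\<Sum>i\<in>{r1<..n}. row_occ n N i l) = (\<Sum>i\<in>{r1<..n}. \<Sum>j\<in>{0..r2}. H i l j)"
      using row2 l by (intro sum.cong) auto
    also have "\<dots> = (\<Sum>j\<in>{0..r2}. \<Sum>i\<in>{r1<..n}. H i l j)" by (rule sum.swap)
    also have "\<dots> = (n - r1) * d l + a1 l" using H[OF l] h_row[OF l] by simp
    finally show ?thesis
      unfolding occ_eq_sum_row_occ sum_split_at[OF r1] using row1 l sum_w1'[OF l] by simp
  qed
  have "equitable_latin_square n k \<rho> N"
    unfolding equitable_latin_rectangle_def
    using array rows cols total by (simp add: rho_floor_eq rho_ceil_eq[OF n] c_def d_def)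
  moreover have "extends_to r1 r2 M N" by (auto simp: extends_to_def N_def)
  ultimately show ?thesis by blast
qed

section \<open>Necessity, and the equivalence\<close>

text \<open>The row and column contents of \<open>N\<close> serve as \<open>w\<close>, and
  \<open>a l t\<close> is the excess over the floor in the new lines. The conditions on one
  direction come from \<open>line_contents_feasible\<close>; those involving
  \<open>occ r1 r2 M l\<close> are counted directly in \<open>N\<close>.\<close>

lemma extension_imp_feasible:
  fixes M N :: array
  assumes n: "n > 0" and r1: "r1 \<le> n" and r2: "r2 \<le> n"
    and N: "equitable_latin_square n k \<rho> N" and ext: "extends_to r1 r2 M N"
  shows "\<exists>a. feasible n k \<rho> r1 r2 M a \<and>
      (\<forall>t\<in>{1, 2}.
        (\<forall>l\<in>{1..k}. int (\<rho> l) - int (occ r1 r2 M l)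
            \<ge> (int n - int (num_lines r1 r2 t)) * rho_floor n \<rho> l) \<and>
        (\<forall>Z. Z \<subseteq> {1..num_lines r1 r2 t} \<longrightarrow>
          int n * int (card Z) \<ge>
            (\<Sum>l\<in>{1..k}. int (card Z) * rho_ceil n \<rho> l
               - min (f_val n \<rho> r1 r2 a t l) (int (eta n \<rho> r1 r2 M t Z l)))))"
proof -
  define r where "r = num_lines r1 r2"
  define d where "d l = \<rho> l div n" for l
  define w where "w t = (if t = 1 then row_occ n N else col_occ n N)" for t :: nat
  define a where "a l t = (\<Sum>x\<in>{r t<..n}. w t x l) - (n - r t) * d l" for l t
  have array: "is_array k n n N" using N by (simp add: equitable_latin_rectangle_def)
  have r: "r t \<le> n" for t using r1 r2 by (simp add: r_def num_lines_def)
  have w: "d l \<le> w t x l \<and> w t x l \<le> ceil_div (\<rho> l) n" if "x \<in> {1..n}" "l \<in> {1..k}" for t x l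
    using N that by (auto simp: equitable_latin_rectangle_def w_def d_def rho_floor_eq rho_ceil_eq[OF n])
  have occN: "occ n n N l = \<rho> l" if "l \<in> {1..k}" for l
    using N that n unfolding equitable_latin_rectangle_def
    by (metis atLeastAtMost_iff le_refl less_eq_Suc_le One_nat_def)
  have sum_w: "(\<Sum>l\<in>{1..k}. w t x l) = n" if "x \<in> {1..n}" for t x
    using sum_row_occ[OF array that] sum_col_occ[OF array that] by (simp add: w_def)
  have sum_w': "(\<Sum>x\<in>{1..n}. w t x l) = \<rho> l" if "l \<in> {1..k}" for t l
    using occN[OF that] occ_eq_sum_row_occ[of n n N l] occ_eq_sum_col_occ[of n n N l] by (simp add: w_def)
  have a: "(\<Sum>x\<in>{r t<..n}. w t x l) = (n - r t) * d l + a l t" if "l \<in> {1..k}" for l t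
  proof -
    have "(\<Sum>x\<in>{r t<..n}. d l) \<le> (\<Sum>x\<in>{r t<..n}. w t x l)"
      using w that by (intro sum_mono) auto
    then show ?thesis by (simp add: a_def)
  qed
  have row_eq: "row_occ r2 M x l = (\<Sum>j\<in>{1..r2}. of_bool (N x j = l))" if "x \<in> {1..r1}" for x l
    unfolding row_occ_eq_sum using ext that by (intro sum.cong) (auto simp: extends_to_def)
  have col_eq: "col_occ r1 M x l = (\<Sum>i\<in>{1..r1}. of_bool (N i x = l))" if "x \<in> {1..r2}" for x l
    unfolding col_occ_eq_sum using ext that by (intro sum.cong) (auto simp: extends_to_def)
  have occ_le: "line_occ r1 r2 M t x l \<le> w t x l" if "x \<in> {1..r t}" for t x l
  proof (cases "t = 1")
    case True
    then have "x \<in> {1..r1}" using that by (simp add: r_def num_lines_def)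
    then show ?thesis
      unfolding line_occ_def w_def if_P[OF True]
      by (simp only: row_eq row_occ_eq_sum[of n] sum_split_at[OF r2] le_add1)
  next
    case False
    then have "x \<in> {1..r2}" using that by (simp add: r_def num_lines_def)
    then show ?thesis
      unfolding line_occ_def w_def if_not_P[OF False]
      by (simp only: col_eq col_occ_eq_sum[of n] sum_split_at[OF r1] le_add1)
  qed
  have occ_lines: "occ r1 r2 M l \<le> (\<Sum>x\<in>{1..r t}. w t x l)" for t l
  proof -
    have "occ r1 r2 M l = (\<Sum>x\<in>{1..r t}. line_occ r1 r2 M t x l)"
      using occ_eq_sum_row_occ[of r1 r2 M l] occ_eq_sum_col_occ[of r1 r2 M l]
      by (simp add: r_def num_lines_def line_occ_def)
    then show ?thesis using occ_le by (simp only: sum_mono)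
  qed
  have slack: "occ r1 r2 M l + (n - r t) * d l + a l t \<le> \<rho> l" if l: "l \<in> {1..k}" for t l
    using occ_lines[of l t] sum_w'[OF l, of t] sum_split_at[OF r[of t], of "\<lambda>x. w t x l"] a[OF l, of t]
    by linarith
  \<comment> \<open>Copies of \<open>l\<close> in old rows lie in \<open>M\<close> or in new
    columns, and all others lie in new rows. Copies in the corner are counted twice, hence only an
    inequality.\<close>
  have corner: "\<rho> l \<le> occ r1 r2 M l + ((n - r1) * d l + a l 1) + ((n - r2) * d l + a l 2)"
    if l: "l \<in> {1..k}" for l
  proof -
    have "(\<Sum>i\<in>{1..r1}. row_occ n N i l) =
        (\<Sum>i\<in>{1..r1}. row_occ r2 M i l + (\<Sum>j\<in>{r2<..n}. of_bool (N i j = l)))"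
      by (intro sum.cong refl) (simp only: row_eq row_occ_eq_sum[of n] sum_split_at[OF r2])
    also have "\<dots> = occ r1 r2 M l + (\<Sum>j\<in>{r2<..n}. \<Sum>i\<in>{1..r1}. of_bool (N i j = l))"
      unfolding sum.distrib occ_eq_sum_row_occ by (subst sum.swap) (rule refl)
    also have "\<dots> \<le> occ r1 r2 M l + (\<Sum>j\<in>{r2<..n}. col_occ n N j l)"
      by (intro add_left_mono sum_mono) (simp only: col_occ_eq_sum sum_split_at[OF r1] le_add1)
    finally have "(\<Sum>i\<in>{1..r1}. row_occ n N i l) \<le> occ r1 r2 M l + ((n - r2) * d l + a l 2)"
      using a[OF l, of 2] by (simp add: w_def r_def num_lines_def)
    moreover have "(\<Sum>i\<in>{1..r1}. row_occ n N i l) + ((n - r1) * d l + a l 1) = \<rho> l"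
      using a[OF l, of 1] sum_w'[OF l, of 1] sum_split_at[OF r1, of "\<lambda>i. row_occ n N i l"]
      by (simp add: w_def r_def num_lines_def)
    ultimately show ?thesis by linarith
  qed
  have lines: "(\<forall>l\<in>{1..k}.
      int (a l t) \<ge> int (\<rho> l) - int (r t) * rho_ceil n \<rho> l - (int n - int (r t)) * rho_floor n \<rho> l \<and>
      int (a l t) \<le> min (int n * rho_ceil n \<rho> l) (int (\<rho> l) + int (eta n \<rho> r1 r2 M t {1..r t} l))
        - int (r t) * rho_ceil n \<rho> l - (int n - int (r t)) * rho_floor n \<rho> l) \<and>
    (\<Sum>l\<in>{1..k}. int (a l t)) = (int n - int (r t)) * (int n - (\<Sum>l\<in>{1..k}. rho_floor n \<rho> l)) \<and>
    (\<forall>Z. Z \<subseteq> {1..r t} \<longrightarrow> (\<Sum>l\<in>{1..k}. int (card Z) * rho_ceil n \<rho> l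
        - min (f_val n \<rho> r1 r2 a t l) (int (eta n \<rho> r1 r2 M t Z l))) \<le> int n * int (card Z))" for t
    unfolding r_def
    by (rule line_contents_feasible[where w = "w t"])
      (use n r occ_le w sum_w sum_w' a in \<open>auto simp: r_def d_def\<close>)
  have "int (a l 1) + int (a l 2) \<ge> int (\<rho> l) - int (occ r1 r2 M l)
      - (2 * int n - int r1 - int r2) * rho_floor n \<rho> l" if l: "l \<in> {1..k}" for l
  proof -
    have "int (\<rho> l) \<le> int (occ r1 r2 M l + ((n - r1) * d l + a l 1) + ((n - r2) * d l + a l 2))"
      using corner[OF l] by (simp only: of_nat_le_iff)
    then have "int (\<rho> l) \<le> int (occ r1 r2 M l) + ((int n - int r1) * int (d l) + int (a l 1))
        + ((int n - int r2) * int (d l) + int (a l 2))"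
      using r1 r2 by (simp only: of_nat_add of_nat_mult of_nat_diff)
    then show ?thesis by (simp add: rho_floor_eq d_def algebra_simps)
  qed
  moreover have "(int n - int (r t)) * rho_floor n \<rho> l \<le> int (\<rho> l) - int (occ r1 r2 M l)"
    if l: "l \<in> {1..k}" for t l
  proof -
    have "int (occ r1 r2 M l + (n - r t) * d l + a l t) \<le> int (\<rho> l)"
      using slack[OF l] by (simp only: of_nat_le_iff)
    then have "int (occ r1 r2 M l) + (int n - int (r t)) * int (d l) + int (a l t) \<le> int (\<rho> l)"
      using r[of t] by (simp only: of_nat_add of_nat_mult of_nat_diff)
    then show ?thesis by (simp add: rho_floor_eq d_def)
  qed
  ultimately show ?thesis
    using lines unfolding r_def feasible_def by (intro exI[of _ a]) blast
qed

theorem theorem1p3: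
  fixes r1 r2 n k :: nat and \<rho> :: "nat \<Rightarrow> nat" and M :: array
  assumes "r1 > 0" and "r2 > 0" and "n > 0"
    and "min r1 r2 < n" and "max r1 r2 \<le> n"
    and "1 \<le> k" and "k \<le> n\<^sup>2"
    and "\<forall>l\<in>{1..k}. 1 \<le> \<rho> l \<and> \<rho> l \<le> n\<^sup>2"
    and "(\<Sum>l\<in>{1..k}. \<rho> l) = n\<^sup>2"
    and "equitable_latin_rectangle n k \<rho> r1 r2 M"
  shows "(\<exists>N. equitable_latin_square n k \<rho> N \<and> extends_to r1 r2 M N) \<longleftrightarrow>
    (\<exists>a. feasible n k \<rho> r1 r2 M a \<and>
      (\<forall>t\<in>{1, 2}.
        (\<forall>l\<in>{1..k}. int (\<rho> l) - int (occ r1 r2 M l)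
            \<ge> (int n - int (num_lines r1 r2 t)) * rho_floor n \<rho> l) \<and>
        (\<forall>Z. Z \<subseteq> {1..num_lines r1 r2 t} \<longrightarrow>
          int n * int (card Z) \<ge>
            (\<Sum>l\<in>{1..k}. int (card Z) * rho_ceil n \<rho> l
               - min (f_val n \<rho> r1 r2 a t l) (int (eta n \<rho> r1 r2 M t Z l))))))"
    (is "?L \<longleftrightarrow> (\<exists>a. feasible n k \<rho> r1 r2 M a \<and> ?Q a)")
proof
  assume ?L
  then show "\<exists>a. feasible n k \<rho> r1 r2 M a \<and> ?Q a"
    using assms by (elim exE conjE) (rule extension_imp_feasible, auto)
next
  assume "\<exists>a. feasible n k \<rho> r1 r2 M a \<and> ?Q a"
  then obtain a where feas: "feasible n k \<rho> r1 r2 M a" and Q: "?Q a" by blast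
  have n: "n > 0" and r1: "r1 \<le> n" and r2: "r2 \<le> n" using assms by auto
  have M: "is_array k r1 r2 M" using assms by (simp add: equitable_latin_rectangle_def)
  define r where "r = num_lines r1 r2"
  have r12: "r 1 = r1" "r 2 = r2" by (auto simp: r_def num_lines_def)
  have r: "r t \<le> n" for t using r1 r2 by (simp add: r_def num_lines_def)
  have occ_le: "line_occ r1 r2 M t x l \<le> ceil_div (\<rho> l) n"
    if "x \<in> {1..r t}" "l \<in> {1..k}" for t x l
  proof -
    have "int (row_occ r2 M i l) \<le> rho_ceil n \<rho> l \<and> int (col_occ r1 M j l) \<le> rho_ceil n \<rho> l"
      if "i \<in> {1..r1}" "j \<in> {1..r2}" for i j
      using assms(10) \<open>l \<in> {1..k}\<close> that unfolding equitable_latin_rectangle_def by blast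
    \<comment> \<open>The rectangle's definition bounds rows and columns jointly, so a row bound
      needs some column and vice versa; index 1 exists because \<open>r1\<close> and
      \<open>r2\<close> are positive.\<close>
    from this[of x 1] this[of 1 x] show ?thesis
      using that assms(1,2) by (auto simp: line_occ_def r_def num_lines_def rho_ceil_eq[OF n])
  qed
  have feas_i: "int (\<rho> l) - int (r t) * rho_ceil n \<rho> l - (int n - int (r t)) * rho_floor n \<rho> l \<le> int (a l t)"
    and feas_ii: "int (a l t) \<le> min (int n * rho_ceil n \<rho> l) (int (\<rho> l) + int (eta n \<rho> r1 r2 M t {1..r t} l))
        - int (r t) * rho_ceil n \<rho> l - (int n - int (r t)) * rho_floor n \<rho> l"
    if "l \<in> {1..k}" "t \<in> {1, 2}" for l t
    using feas that unfolding feasible_def r_def by blast+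
  have feas_iii: "int (\<rho> l) - int (occ r1 r2 M l) - (2 * int n - int r1 - int r2) * rho_floor n \<rho> l
      \<le> int (a l 1) + int (a l 2)" if "l \<in> {1..k}" for l
    using feas that unfolding feasible_def by blast
  have feas_iv: "(\<Sum>l\<in>{1..k}. int (a l t)) = (int n - int (r t)) * (int n - (\<Sum>l\<in>{1..k}. rho_floor n \<rho> l))"
    if "t \<in> {1, 2}" for t
    using feas that unfolding feasible_def r_def by blast
  have lines: "\<exists>w. (\<forall>x\<in>{1..r t}. \<forall>l\<in>{1..k}. line_occ r1 r2 M t x l \<le> w x l \<and> \<rho> l div n \<le> w x l \<and>
        w x l \<le> ceil_div (\<rho> l) n) \<and>
      (\<forall>x\<in>{1..r t}. (\<Sum>l\<in>{1..k}. w x l) = n) \<and>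
      (\<forall>l\<in>{1..k}. (\<Sum>x\<in>{1..r t}. w x l) + ((n - r t) * (\<rho> l div n) + a l t) = \<rho> l)"
    if t: "t \<in> {1, 2}" for t
    unfolding r_def
  proof (rule line_contents_exist)
    show "0 \<le> f_val n \<rho> r1 r2 a t l" if "l \<in> {1..k}" for l
      using feas_i[OF that t] by (simp add: f_val_def r_def)
  qed (use n r occ_le assms(9) feas_iv[OF t] Q t in \<open>auto simp: r_def\<close>)
  obtain w1 where w1:
    "\<forall>x\<in>{1..r1}. \<forall>l\<in>{1..k}. row_occ r2 M x l \<le> w1 x l \<and> \<rho> l div n \<le> w1 x l \<and> w1 x l \<le> ceil_div (\<rho> l) n"
    "\<forall>x\<in>{1..r1}. (\<Sum>l\<in>{1..k}. w1 x l) = n"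
    "\<forall>l\<in>{1..k}. (\<Sum>x\<in>{1..r1}. w1 x l) + ((n - r1) * (\<rho> l div n) + a l 1) = \<rho> l"
    using lines[of 1] unfolding r12 line_occ_def by auto
  obtain w2 where w2:
    "\<forall>x\<in>{1..r2}. \<forall>l\<in>{1..k}. col_occ r1 M x l \<le> w2 x l \<and> \<rho> l div n \<le> w2 x l \<and> w2 x l \<le> ceil_div (\<rho> l) n"
    "\<forall>x\<in>{1..r2}. (\<Sum>l\<in>{1..k}. w2 x l) = n"
    "\<forall>l\<in>{1..k}. (\<Sum>x\<in>{1..r2}. w2 x l) + ((n - r2) * (\<rho> l div n) + a l 2) = \<rho> l"
    using lines[of 2] unfolding r12 line_occ_def by auto
  \<comment> \<open>The first argument of the minimum yields \<open>n - r t\<close> times the gap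
    between ceiling and floor, which is 1 for free symbols and 0 for forced ones.\<close>
  have a: "a l t \<le> n - r t \<and> (n dvd \<rho> l \<longrightarrow> a l t = 0)" if "l \<in> {1..k}" "t \<in> {1, 2}" for l t
  proof -
    have "int (a l t) \<le> int n * rho_ceil n \<rho> l - int (r t) * rho_ceil n \<rho> l - (int n - int (r t)) * rho_floor n \<rho> l"
      using feas_ii[OF that] by linarith
    also have "\<dots> = (int n - int (r t)) * of_bool (\<not> n dvd \<rho> l)"
      by (simp add: rho_ceil_eq[OF n] rho_floor_eq ceil_div_def algebra_simps)
    finally show ?thesis using r[of t] by (auto simp: of_bool_def split: if_splits)
  qed
  \<comment> \<open>The prescribed sum of the \<open>a l 1\<close> says that the new rows receive as
    many symbols as they have cells.\<close>
  have "(\<Sum>l\<in>{1..k}. (n - r1) * (\<rho> l div n) + a l 1) = (n - r1) * n"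
  proof -
    have "int (\<Sum>l\<in>{1..k}. (n - r1) * (\<rho> l div n) + a l 1) =
        (int n - int r1) * (\<Sum>l\<in>{1..k}. int (\<rho> l div n)) + (\<Sum>l\<in>{1..k}. int (a l 1))"
      using r1 by (simp only: of_nat_sum of_nat_add of_nat_mult of_nat_diff sum.distrib sum_distrib_left)
    also have "\<dots> = (int n - int r1) * int n"
      using feas_iv[of 1] unfolding r12 by (simp add: rho_floor_eq algebra_simps)
    also have "\<dots> = int ((n - r1) * n)" using r1 by (simp only: of_nat_mult of_nat_diff)
    finally show ?thesis by (simp only: of_nat_eq_iff)
  qed
  \<comment> \<open>The lower bound on \<open>a l 1 + a l 2\<close> says that the number of copies
    of \<open>l\<close> due in the corner is nonnegative.\<close>
  moreover have "\<rho> l \<le> occ r1 r2 M l + ((n - r1) * (\<rho> l div n) + a l 1) + ((n - r2) * (\<rho> l div n) + a l 2)"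
    if l: "l \<in> {1..k}" for l
  proof -
    have "int (\<rho> l) \<le> int (occ r1 r2 M l) + ((int n - int r1) * int (\<rho> l div n) + int (a l 1))
        + ((int n - int r2) * int (\<rho> l div n) + int (a l 2))"
      using feas_iii[OF l] by (simp add: rho_floor_eq algebra_simps)
    also have "\<dots> = int (occ r1 r2 M l + ((n - r1) * (\<rho> l div n) + a l 1) + ((n - r2) * (\<rho> l div n) + a l 2))"
      using r1 r2 by (simp only: of_nat_add of_nat_mult of_nat_diff)
    finally show ?thesis by (simp only: of_nat_le_iff)
  qed
  ultimately show ?L
    using w1 w2 a[of _ 1] a[of _ 2] unfolding r12
    by (intro extension_exists[OF n r1 r2 M, where ?w1.0 = w1 and ?w2.0 = w2 and
          ?a1.0 = "\<lambda>l. a l 1" and ?a2.0 = "\<lambda>l. a l 2"]) auto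
qed

end
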